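(* Let $k,m,r\ge1$ be integers, $q=2r-1$, and let $L=P(2k,2r-1,2m)$ be the oriented ordered two-component pretzel link with its canonical meridional coefficient system. Put $R=\mathbb Q[x,y]$ with $y=t_1$, $x=t_2$, let $I:=E_2(L)\cap R$, and set $$A_q(x)=\frac{1+x^q}{1+x},\qquad G_k(x,y)=\frac{1-(xy)^k}{1-xy},\qquad H_m(x,y)=\frac{x^m-y^m}{x-y}.$$ Then $$I=\langle A_q(x),\,G_k(x,y),\,H_m(x,y)\rangle\subset R.$$ Consequently, $\mathrm{AG}_2(L)$ is the reduced Gröbner basis of $I\subset R$ for the lexicographic order with $y>x$. Moreover, in $R/I$ one has $(xy)^k=1$ and $x^m=y^m$.
   Context: Put $\Lambda=\mathbb Q[x^{\pm1},y^{\pm1}]$ with $y=t_1$, $x=t_2$; the fixed lexicographic order $t_1>t_2$ is then the lexicographic order with $y>x$. The expressions $A_q,G_k,H_m$ are polynomials ($q$ is odd). For a finitely presented group $G=\langle x_1,\dots,x_n\mid r_1,\dots,r_s\rangle$ with an epimorphism $\phi\colon G\to\mathbb Z^2$, let $\Phi\colon\mathbb Z[F_n]\to\Lambda$ be the induced ring map ($F_n$ the free group on the $x_j$, with the standard basis vector $e_i$ corresponding to $t_i$), and let $A_\phi=(\Phi(\partial r_i/\partial x_j))$ be the $s\times n$ Fox matrix. The $j$th elementary ideal $E_j(G,\phi)\subset\Lambda$ is the ideal generated by the $(n-j)\times(n-j)$ minors of $A_\phi$ (independent of the presentation). $\mathrm{AG}_j(G,\phi)$ is the reduced Gröbner basis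 of $E_j(G,\phi)\cap R$ for the lexicographic order $y>x$. For an oriented ordered two-component link $L\subset S^3$ with exterior $X_L$, $E_j(L)=E_j(\pi_1(X_L),\phi)$ and $\mathrm{AG}_j(L)=\mathrm{AG}_j(\pi_1(X_L),\phi)$, where $\phi$ sends the positive meridian of the $i$th component to $e_i$. For $L=P(2k,2r-1,2m)$, with the orientation and ordering used in the paper, $\pi_1(X_L)=\langle a,b,c\mid r_1,r_2\rangle$ with $$r_1=(cb)^r b^{-1}(cb)^{-r}(ac^{-1})^m c(ca^{-1})^m,\qquad r_2=(ab)^{-k}b(ab)^k(cb)^{r-1}c^{-1}(cb)^{-(r-1)},$$ where $a,b,c$ are oriented meridians, $a$ of the first component and $b,c$ of the second, so $\phi(a)=e_1$, $\phi(b)=\phi(c)=e_2$; i.e. $a\mapsto y$ and $b,c\mapsto x$. *)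

theory Defs
  imports
    "HOL-Library.Poly_Mapping"
    "HOL-Library.Product_Plus"
    "HOL-Library.Product_Lexorder"
    "HOL-Algebra.QuotRing"
    "HOL-Algebra.Algebraic_Closure_Type"
    "Jordan_Normal_Form.Determinant"
    "Jordan_Normal_Form.DL_Submatrix"
begin

section \<open>Free groups and the Fox calculus\<close>

text \<open>
  Words are lists of letters; \<open>(x, True)\<close> stands for \<open>x\<close> and \<open>(x, False)\<close> for its inverse.
  The exponents of \<^type>\<open>poly_mapping\<close> are additive monoids, so the (non-commutative) free group
  is written additively: \<open>u + v\<close> is the product \<open>uv\<close>, \<open>- u\<close> the inverse of \<open>u\<close>, and
  \<open>u - v\<close> is \<open>u\<close> times the inverse of \<open>v\<close>.  The type \<open>'a free_group \<Rightarrow>\<^sub>0 int\<close> is then the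
  integral group ring of the free group, with \<open>Poly_Mapping.single u 1\<close> the group element \<open>u\<close>.
\<close>

type_synonym 'a word = "('a \<times> bool) list"

inductive free_eq :: "'a word \<Rightarrow> 'a word \<Rightarrow> bool" where
  refl: "free_eq u u"
| sym: "free_eq u v \<Longrightarrow> free_eq v u"
| trans: "free_eq u v \<Longrightarrow> free_eq v w \<Longrightarrow> free_eq u w"
| cancel: "free_eq (u @ (x, b) # (x, \<not> b) # v) (u @ v)"

lemma free_eq_append_left: "free_eq u v \<Longrightarrow> free_eq (w @ u) (w @ v)"
proof (induction rule: free_eq.induct)
  case (cancel u x b v)
  then show ?case using free_eq.cancel[of "w @ u" x b v] by simp
qed (auto intro: free_eq.intros)

lemma free_eq_append_right: "free_eq u v \<Longrightarrow> free_eq (u @ w) (v @ w)"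
proof (induction rule: free_eq.induct)
  case (cancel u x b v)
  then show ?case using free_eq.cancel[of u x b "v @ w"] by simp
qed (auto intro: free_eq.intros)

definition inv_word :: "'a word \<Rightarrow> 'a word" where
  "inv_word w = rev (map (\<lambda>(x, b). (x, \<not> b)) w)"

lemma free_eq_inv_word: "free_eq u v \<Longrightarrow> free_eq (inv_word u) (inv_word v)"
proof (induction rule: free_eq.induct)
  case (cancel u x b v)
  then show ?case using free_eq.cancel[of "inv_word v" x b "inv_word u"] by (simp add: inv_word_def)
qed (auto intro: free_eq.intros)

lemma free_eq_inv_word_left: "free_eq (inv_word u @ u) []"
proof (induction u)
  case Nil
  then show ?case by (simp add: inv_word_def free_eq.refl)
next
  case (Cons l u)
  obtain x b where l: "l = (x, b)" by (cases l)
  have "free_eq (inv_word (l # u) @ l # u) (inv_word u @ u)"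
    using free_eq.cancel[of "inv_word u" x "\<not> b" u] by (simp add: l inv_word_def)
  then show ?case using Cons by (rule free_eq.trans)
qed

quotient_type 'a free_group = "'a word" / free_eq
  by (rule equivpI) (auto intro!: reflpI sympI transpI intro: free_eq.intros)

instantiation free_group :: (type) group_add
begin

lift_definition zero_free_group :: "'a free_group" is "[]" .

lift_definition plus_free_group :: "'a free_group \<Rightarrow> 'a free_group \<Rightarrow> 'a free_group" is "(@)"
  by (meson free_eq.trans free_eq_append_left free_eq_append_right)

lift_definition uminus_free_group :: "'a free_group \<Rightarrow> 'a free_group" is inv_word
  by (rule free_eq_inv_word)

definition minus_free_group :: "'a free_group \<Rightarrow> 'a free_group \<Rightarrow> 'a free_group" where
  "minus_free_group u v = u + - v"

instance
proof
  fix u v w :: "'a free_group"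
  show "u + v + w = u + (v + w)" by transfer (simp add: free_eq.refl)
  show "0 + u = u" by transfer (simp add: free_eq.refl)
  show "u + 0 = u" by transfer (simp add: free_eq.refl)
  show "- u + u = 0" by transfer (rule free_eq_inv_word_left)
  show "u + - v = u - v" by (simp add: minus_free_group_def)
qed

end

lift_definition free_gen :: "'a \<Rightarrow> 'a free_group" is "\<lambda>x. [(x, True)]" .

definition group_pow :: "'g::group_add \<Rightarrow> nat \<Rightarrow> 'g" where
  "group_pow u n = sum_list (replicate n u)"

lift_definition free_hom :: "('a \<Rightarrow> 'g::group_add) \<Rightarrow> 'a free_group \<Rightarrow> 'g"
  is "\<lambda>f w. \<Sum>(x, b)\<leftarrow>w. if b then f x else - f x"
proof -
  fix f :: "'a \<Rightarrow> 'g" and u v :: "'a word"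
  assume "free_eq u v"
  then show "(\<Sum>(x, b)\<leftarrow>u. if b then f x else - f x) = (\<Sum>(x, b)\<leftarrow>v. if b then f x else - f x)"
    by (induction rule: free_eq.induct) (auto simp: add.assoc)
qed

lemma free_hom_simps [simp]:
  "free_hom f (free_gen x) = f x"
  "free_hom f 0 = 0"
  "free_hom f (u + v) = free_hom f u + free_hom f v"
  by (transfer; simp)+

lemma free_hom_uminus [simp]: "free_hom f (- u) = - free_hom f u"
  using free_hom_simps(3)[of f "- u" u] by (simp add: eq_neg_iff_add_eq_0)

lemma free_hom_minus [simp]: "free_hom f (u - v) = free_hom f u - free_hom f v"
  by (simp only: diff_conv_add_uminus free_hom_simps free_hom_uminus)

lemma free_hom_group_pow [simp]: "free_hom f (group_pow u n) = group_pow (free_hom f u) n"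
  by (induction n) (simp_all add: group_pow_def)

text \<open>
  \<open>fox_word j w\<close> is the Fox derivative of \<open>w\<close> with respect to the generator \<open>j\<close>, computed letter
  by letter from \<open>\<partial>(uv) = \<partial>u + u \<partial>v\<close>.
\<close>

fun fox_word :: "'a \<Rightarrow> 'a word \<Rightarrow> ('a free_group \<Rightarrow>\<^sub>0 int)" where
  "fox_word j [] = 0"
| "fox_word j ((x, True) # w) =
     (if x = j then 1 else 0) + Poly_Mapping.single (free_gen x) 1 * fox_word j w"
| "fox_word j ((x, False) # w) =
     (if x = j then - Poly_Mapping.single (- free_gen x) 1 else 0)
       + Poly_Mapping.single (- free_gen x) 1 * fox_word j w"

lemma single_mult_cancel:
  "Poly_Mapping.single u (1::int) * (Poly_Mapping.single (- u) 1 * p) = p"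
  "Poly_Mapping.single (- u) (1::int) * (Poly_Mapping.single u 1 * p) = p"
  for u :: "'a free_group"
  by (simp_all add: mult.assoc[symmetric] mult_single)

lemma fox_word_append_cong: "fox_word j u = fox_word j v \<Longrightarrow> fox_word j (w @ u) = fox_word j (w @ v)"
proof (induction w)
  case (Cons l w)
  then show ?case by (cases l; cases "snd l") auto
qed simp

lift_definition fox :: "'a \<Rightarrow> 'a free_group \<Rightarrow> ('a free_group \<Rightarrow>\<^sub>0 int)" is fox_word
proof -
  fix j :: 'a and u v :: "'a word"
  assume "free_eq u v"
  then show "fox_word j u = fox_word j v"
  proof (induction rule: free_eq.induct)
    case (cancel u x b v)
    have "fox_word j ((x, b) # (x, \<not> b) # v) = fox_word j v"
      by (cases b) (auto simp: distrib_left single_mult_cancel mult_single)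
    then show ?case by (rule fox_word_append_cong)
  qed auto
qed

lemma fox_gen: "fox j (free_gen x) = (if x = j then 1 else 0)"
  by transfer simp

lemma fox_zero: "fox j 0 = 0"
  by transfer simp

lemma fox_add: "fox j (u + v) = fox j u + Poly_Mapping.single u 1 * fox j v"
proof -
  have *: "fox_word j (u @ v) = fox_word j u + Poly_Mapping.single (abs_free_group u) 1 * fox_word j v"
    for u v :: "'a word"
  proof (induction u)
    case Nil
    then show ?case by (simp flip: zero_free_group.abs_eq)
  next
    case (Cons l u)
    obtain x b where l: "l = (x, b)" by (cases l)
    have "abs_free_group (l # u) = abs_free_group [l] + abs_free_group u"
      by (simp add: plus_free_group.abs_eq)
    also have "abs_free_group [l] = (if b then free_gen x else - free_gen x)"
      by (simp add: l free_gen.abs_eq uminus_free_group.abs_eq inv_word_def)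
    finally show ?case
      using Cons by (cases b) (simp_all add: l algebra_simps mult_single flip: mult.assoc)
  qed
  show ?thesis
  proof (induction u, induction v)
    fix u v :: "'a word"
    show "fox j (abs_free_group u + abs_free_group v) = fox j (abs_free_group u)
      + Poly_Mapping.single (abs_free_group u) 1 * fox j (abs_free_group v)"
      using * by (simp add: plus_free_group.abs_eq fox.abs_eq)
  qed
qed

section \<open>The rings \<open>\<rat>[x, y] \<subseteq> \<rat>[x\<^sup>\<plusminus>\<^sup>1, y\<^sup>\<plusminus>\<^sup>1]\<close>\<close>

text \<open>
  The exponent \<open>(i, j)\<close> stands for the monomial \<open>t\<^sub>1\<^sup>i t\<^sub>2\<^sup>j = y\<^sup>i x\<^sup>j\<close>, so that the lexicographic
  order on pairs of integers is the lexicographic monomial order with \<open>y > x\<close>.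
\<close>

type_synonym laurent = "int \<times> int \<Rightarrow>\<^sub>0 rat"

definition laurent_y :: laurent where "laurent_y = Poly_Mapping.single (1, 0) 1"
definition laurent_x :: laurent where "laurent_x = Poly_Mapping.single (0, 1) 1"

abbreviation Laurent_Qxy :: "laurent ring" where
  "Laurent_Qxy \<equiv> ring_of_type_algebra"

definition Poly_Qxy :: "laurent ring" where
  "Poly_Qxy = Laurent_Qxy \<lparr>carrier := {f. \<forall>(i, j) \<in> Poly_Mapping.keys f. 0 \<le> i \<and> 0 \<le> j}\<rparr>"

instance prod :: (linordered_ab_group_add, linordered_ab_group_add) ordered_cancel_comm_monoid_add
  by standard (auto simp: less_eq_prod_def)

text \<open>The quotient \<open>p / d\<close> when \<open>d\<close> divides \<open>p\<close>; only used in that case.\<close>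

definition exact_quot :: "laurent \<Rightarrow> laurent \<Rightarrow> laurent" where
  "exact_quot p d = (THE f. f * d = p)"

lemma exact_quot_eqI: "d \<noteq> 0 \<Longrightarrow> f * d = p \<Longrightarrow> exact_quot p d = f"
  unfolding exact_quot_def by (rule the_equality) auto

definition A_poly :: "nat \<Rightarrow> laurent" where
  "A_poly q = exact_quot (1 + laurent_x ^ q) (1 + laurent_x)"

definition G_poly :: "nat \<Rightarrow> laurent" where
  "G_poly k = exact_quot (1 - (laurent_x * laurent_y) ^ k) (1 - laurent_x * laurent_y)"

definition H_poly :: "nat \<Rightarrow> laurent" where
  "H_poly m = exact_quot (laurent_x ^ m - laurent_y ^ m) (laurent_x - laurent_y)"

lemma laurent_denominators_nonzero:
  "1 + laurent_x \<noteq> 0" "1 - laurent_x * laurent_y \<noteq> 0" "laurent_x - laurent_y \<noteq> 0"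
proof -
  have "Poly_Mapping.lookup (1 + laurent_x) 0 \<noteq> 0" "Poly_Mapping.lookup (1 - laurent_x * laurent_y) 0 \<noteq> 0"
    "Poly_Mapping.lookup (laurent_x - laurent_y) (1, 0) \<noteq> 0"
    by (simp_all add: laurent_x_def laurent_y_def lookup_add lookup_minus lookup_one mult_single
        lookup_single zero_prod_def when_def)
  then show "1 + laurent_x \<noteq> 0" "1 - laurent_x * laurent_y \<noteq> 0" "laurent_x - laurent_y \<noteq> 0"
    by force+
qed

lemma A_poly_eq_sum:
  assumes "odd q"
  shows "A_poly q = (\<Sum>i<q. (- laurent_x) ^ i)"
  unfolding A_poly_def
proof (rule exact_quot_eqI)
  show "(\<Sum>i<q. (- laurent_x) ^ i) * (1 + laurent_x) = 1 + laurent_x ^ q"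
    using one_diff_power_eq[of "- laurent_x" q] assms by (simp add: mult.commute)
qed (rule laurent_denominators_nonzero)

lemma G_poly_eq_sum: "G_poly k = (\<Sum>i<k. (laurent_x * laurent_y) ^ i)"
  unfolding G_poly_def
proof (rule exact_quot_eqI)
  show "(\<Sum>i<k. (laurent_x * laurent_y) ^ i) * (1 - laurent_x * laurent_y)
      = 1 - (laurent_x * laurent_y) ^ k"
    using one_diff_power_eq[of "laurent_x * laurent_y" k] by (simp add: mult.commute)
qed (rule laurent_denominators_nonzero)

lemma H_poly_eq_sum: "H_poly m = (\<Sum>i<m. laurent_y ^ (m - Suc i) * laurent_x ^ i)"
  unfolding H_poly_def
proof (rule exact_quot_eqI)
  show "(\<Sum>i<m. laurent_y ^ (m - Suc i) * laurent_x ^ i) * (laurent_x - laurent_y)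
      = laurent_x ^ m - laurent_y ^ m"
    using power_diff_sumr2[of laurent_x m laurent_y] by (simp add: mult.commute)
qed (rule laurent_denominators_nonzero)

section \<open>Reduced Groebner bases in \<open>\<rat>[x, y]\<close>\<close>

definition lex_exponent :: "laurent \<Rightarrow> int \<times> int" where
  "lex_exponent f = Max (Poly_Mapping.keys f)"

definition lex_coeff :: "laurent \<Rightarrow> rat" where
  "lex_coeff f = Poly_Mapping.lookup f (lex_exponent f)"

definition lex_term :: "laurent \<Rightarrow> laurent" where
  "lex_term f = Poly_Mapping.single (lex_exponent f) (lex_coeff f)"

definition is_groebner_basis :: "laurent set \<Rightarrow> laurent set \<Rightarrow> bool" where
  "is_groebner_basis B I \<longleftrightarrow> finite B \<and> B \<subseteq> I \<and>
     Idl\<^bsub>Poly_Qxy\<^esub> (lex_term ` B) = Idl\<^bsub>Poly_Qxy\<^esub> (lex_term ` (I - {0}))"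

definition is_reduced_groebner_basis :: "laurent set \<Rightarrow> laurent set \<Rightarrow> bool" where
  "is_reduced_groebner_basis B I \<longleftrightarrow> is_groebner_basis B I \<and>
     (\<forall>p\<in>B. lex_coeff p = 1) \<and>
     (\<forall>p\<in>B. \<forall>e\<in>Poly_Mapping.keys p.
        Poly_Mapping.single e 1 \<notin> Idl\<^bsub>Poly_Qxy\<^esub> (lex_term ` (B - {p})))"

section \<open>Elementary ideals\<close>

text \<open>
  The generators are numbered \<open>0, \<dots>, num_gens - 1\<close>; the relators are words in these generators.
  A homomorphism \<open>\<phi>\<close> to \<open>\<int>\<^sup>2\<close> is given by the images of the generators.
\<close>

record presentation =
  num_gens :: nat
  relators :: "nat free_group list"

definition group_ring_map :: "(nat \<Rightarrow> int \<times> int) \<Rightarrow> (nat free_group \<Rightarrow>\<^sub>0 int) \<Rightarrow> laurent" where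
  "group_ring_map \<phi> p = (\<Sum>u\<in>Poly_Mapping.keys p.
     Poly_Mapping.single (free_hom \<phi> u) (of_int (Poly_Mapping.lookup p u)))"

definition fox_matrix :: "presentation \<Rightarrow> (nat \<Rightarrow> int \<times> int) \<Rightarrow> laurent mat" where
  "fox_matrix P \<phi> = mat (length (relators P)) (num_gens P)
     (\<lambda>(i, j). group_ring_map \<phi> (fox j (relators P ! i)))"

definition minors :: "nat \<Rightarrow> 'a::comm_ring_1 mat \<Rightarrow> 'a set" where
  "minors d M = {det (submatrix M I J) | I J.
     I \<subseteq> {..<dim_row M} \<and> J \<subseteq> {..<dim_col M} \<and> card I = d \<and> card J = d}"

definition elementary_ideal :: "nat \<Rightarrow> presentation \<Rightarrow> (nat \<Rightarrow> int \<times> int) \<Rightarrow> laurent set" where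
  "elementary_ideal j P \<phi> = Idl\<^bsub>Laurent_Qxy\<^esub> (minors (num_gens P - j) (fox_matrix P \<phi>))"

definition AG :: "nat \<Rightarrow> presentation \<Rightarrow> (nat \<Rightarrow> int \<times> int) \<Rightarrow> laurent set" where
  "AG j P \<phi> = (THE B. is_reduced_groebner_basis B (elementary_ideal j P \<phi> \<inter> carrier Poly_Qxy))"

section \<open>The pretzel links \<open>P(2k, 2r - 1, 2m)\<close>\<close>

text \<open>
  The link is represented by the presentation of its group on oriented meridians
  \<open>a, b, c\<close> (generators 0, 1, 2), \<open>a\<close> belonging to the first component and \<open>b, c\<close> to the second.
  Multiplicatively, the relators are
  \<open>(cb)\<^sup>r b\<inverse> (cb)\<^sup>-\<^sup>r (ac\<inverse>)\<^sup>m c (ca\<inverse>)\<^sup>m\<close> and \<open>(ab)\<^sup>-\<^sup>k b (ab)\<^sup>k (cb)\<^sup>r\<^sup>-\<^sup>1 c\<inverse> (cb)\<^sup>-\<^sup>(\<^sup>r\<^sup>-\<^sup>1\<^sup>)\<close>.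
\<close>

definition pretzel_presentation :: "nat \<Rightarrow> nat \<Rightarrow> nat \<Rightarrow> presentation" where
  "pretzel_presentation k r m =
    (let a = free_gen 0; b = free_gen 1; c = free_gen 2 in
     \<lparr>num_gens = 3,
      relators =
       [group_pow (c + b) r - b - group_pow (c + b) r
          + group_pow (a - c) m + c + group_pow (c - a) m,
        - group_pow (a + b) k + b + group_pow (a + b) k
          + group_pow (c + b) (r - 1) - c - group_pow (c + b) (r - 1)]\<rparr>)"

definition pretzel_phi :: "nat \<Rightarrow> int \<times> int" where
  "pretzel_phi i = (if i = 0 then (1, 0) else (0, 1))"

lemma group_pow_int_pair: "group_pow (i, j) n = (int n * i, int n * j)" for i j :: int
  by (induction n) (simp_all add: group_pow_def algebra_simps zero_prod_def)

lemma pretzel_phi_relators: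
  "w \<in> set (relators (pretzel_presentation k r m)) \<Longrightarrow> free_hom pretzel_phi w = 0"
  by (auto simp: pretzel_presentation_def Let_def pretzel_phi_def group_pow_int_pair zero_prod_def)

lemma pretzel_phi_surj: "surj (free_hom pretzel_phi)"
proof
  show "UNIV \<subseteq> range (free_hom pretzel_phi)"
  proof clarify
    fix i j :: int
    let ?u = "group_pow (free_gen 0) (nat i) - group_pow (free_gen 0) (nat (- i))
      + group_pow (free_gen 1) (nat j) - group_pow (free_gen 1) (nat (- j))"
    have "free_hom pretzel_phi ?u = (i, j)"
      by (simp add: pretzel_phi_def group_pow_int_pair)
    then show "(i, j) \<in> range (free_hom pretzel_phi)"
      by (metis rangeI)
  qed
qed simp

abbreviation pretzel_elementary_ideal :: "nat \<Rightarrow> nat \<Rightarrow> nat \<Rightarrow> nat \<Rightarrow> laurent set" where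
  "pretzel_elementary_ideal j k r m \<equiv> elementary_ideal j (pretzel_presentation k r m) pretzel_phi"

abbreviation pretzel_AG :: "nat \<Rightarrow> nat \<Rightarrow> nat \<Rightarrow> nat \<Rightarrow> laurent set" where
  "pretzel_AG j k r m \<equiv> AG j (pretzel_presentation k r m) pretzel_phi"

end

theory Submission
  imports Defs
begin

text \<open>
  Both relators are products of conjugates of meridians, and the Fox derivative of a conjugate
  \<open>u v u\<inverse>\<close> is, over a commutative ring, \<open>(1 - v) \<partial>u + u \<partial>v\<close>; the derivative of a power is a
  geometric sum.  With \<open>w = (xy)\<^sup>-\<^sup>k\<close> the Fox matrix is, for the columns \<open>a, b, c\<close>,

    \<open>x\<^sup>-\<^sup>m (1 - x) H,   - A,                 A - x\<^sup>-\<^sup>m (1 - y) H\<close>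

    \<open>w (x - 1) G,      A + w (1 - y) G,   - A\<close>

  where \<open>A = A\<^sub>q\<close>, \<open>G = G\<^sub>k\<close>, \<open>H = H\<^sub>m\<close> (\<open>fox_relator1\<close>, \<open>fox_relator2\<close>).  There are three
  generators, so the second elementary ideal is generated by the entries of this matrix, that is, by
  \<open>A\<close>, \<open>(1 - x) G\<close>, \<open>(1 - y) G\<close>, \<open>(1 - x) H\<close> and \<open>(1 - y) H\<close>.  Since \<open>q\<close> is odd,
  \<open>A\<close> is congruent to 1 modulo \<open>1 - x\<close>; hence \<open>1 - x\<close> is invertible modulo \<open>A\<close>, the factors
  \<open>1 - x\<close> can be cancelled, and the ideal is generated by \<open>A, G, H\<close>
  (\<open>pretzel_elementary_ideal_2\<close>).

  The contraction to \<open>\<rat>[x, y]\<close> adds nothing to the ideal that \<open>A, G, H\<close> generate there.  Because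
  \<open>(1 - xy) G = 1 - (xy)\<^sup>k\<close>, the monomial \<open>xy\<close> is already a unit modulo that ideal.  A Laurent
  combination of \<open>A, G, H\<close> becomes a polynomial combination after multiplication by a high power of
  \<open>(xy)\<^sup>k\<close>, and this multiplication does not change a polynomial modulo the ideal
  (\<open>laurent_ideal_contraction\<close>).  The two relations in the quotient are
  \<open>(1 - xy) G = 1 - (xy)\<^sup>k\<close> and \<open>(x - y) H = x\<^sup>m - y\<^sup>m\<close>.

  As \<open>AG\<close> is a definite description, the statement about it amounts to the existence and uniqueness of
  reduced Groebner bases (\<open>reduced_groebner_basis_ex1\<close>).  The leading exponents of an ideal
  form an upward closed set of points of the quadrant, and its minimal points are pairwise
  incomparable, hence finite in number.  Over each minimal point there is exactly one monic element of the ideal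
  all of whose other exponents are outside the set of leading exponents: it is obtained by reducing the tail of any
  element with that leading exponent, and the difference of two such elements has no exponent left
  that could be a leading one.
\<close>

section \<open>Ideals of subrings of a commutative ring\<close>

text \<open>
  The Laurent ring and its polynomial subring have the same operations and differ only in their
  carriers.  Treating them as \<open>ring_on K\<close> for two sets \<open>K\<close> lets ideals be handled by closure
  properties stated in the operations of the ambient type.
\<close>

definition ring_on :: "'a::comm_ring_1 set \<Rightarrow> 'a ring" where
  "ring_on K = ring_of_type_algebra\<lparr>carrier := K\<rparr>"

definition subring_set :: "'a::comm_ring_1 set \<Rightarrow> bool" where
  "subring_set K \<longleftrightarrow> 1 \<in> K \<and> (\<forall>f\<in>K. - f \<in> K) \<and> (\<forall>f\<in>K. \<forall>g\<in>K. f + g \<in> K \<and> f * g \<in> K)"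

lemma ring_on_simps [simp]:
  "carrier (ring_on K) = K" "monoid.mult (ring_on K) = (*)" "add (ring_on K) = (+)"
  "one (ring_on K) = 1" "zero (ring_on K) = 0"
  by (simp_all add: ring_on_def ring_of_type_algebra_def)

lemma subring_setD:
  assumes "subring_set K"
  shows "1 \<in> K" "0 \<in> K" "f \<in> K \<Longrightarrow> - f \<in> K" "f \<in> K \<Longrightarrow> g \<in> K \<Longrightarrow> f + g \<in> K"
    "f \<in> K \<Longrightarrow> g \<in> K \<Longrightarrow> f - g \<in> K" "f \<in> K \<Longrightarrow> g \<in> K \<Longrightarrow> f * g \<in> K" "f \<in> K \<Longrightarrow> f ^ n \<in> K"
proof -
  show 1: "1 \<in> K" "f \<in> K \<Longrightarrow> - f \<in> K" "f \<in> K \<Longrightarrow> g \<in> K \<Longrightarrow> f + g \<in> K"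
    and mult: "f \<in> K \<Longrightarrow> g \<in> K \<Longrightarrow> f * g \<in> K"
    for f g using assms by (auto simp: subring_set_def)
  show "0 \<in> K" using 1(3)[OF 1(1) 1(2)[OF 1(1)]] by simp
  show "f \<in> K \<Longrightarrow> g \<in> K \<Longrightarrow> f - g \<in> K" using 1(3)[of f "- g"] 1(2)[of g] by simp
  show "f \<in> K \<Longrightarrow> f ^ n \<in> K" by (induction n) (auto intro: 1 mult)
qed

lemma subring_set_sum: "subring_set K \<Longrightarrow> (\<And>i. i \<in> S \<Longrightarrow> f i \<in> K) \<Longrightarrow> sum f S \<in> K"
  by (induction S rule: infinite_finite_induct) (auto intro: subring_setD)

lemma cring_ring_on:
  assumes "subring_set K"
  shows "cring (ring_on K)"
proof (rule cringI)
  show "abelian_group (ring_on K)"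
  proof (rule abelian_groupI)
    fix f assume "f \<in> carrier (ring_on K)"
    then show "\<exists>g\<in>carrier (ring_on K). g \<oplus>\<^bsub>ring_on K\<^esub> f = \<zero>\<^bsub>ring_on K\<^esub>"
      using subring_setD(3)[OF assms] by (intro bexI[of _ "- f"]) auto
  qed (auto simp: algebra_simps subring_setD[OF assms])
  show "Group.comm_monoid (ring_on K)"
    by (rule comm_monoidI) (auto simp: algebra_simps subring_setD[OF assms])
qed (auto simp: algebra_simps)

lemma ideal_ring_on_iff:
  assumes K: "subring_set K"
  shows "ideal J (ring_on K) \<longleftrightarrow>
    J \<subseteq> K \<and> 0 \<in> J \<and> (\<forall>f\<in>J. \<forall>g\<in>J. f + g \<in> J) \<and> (\<forall>f\<in>J. \<forall>g\<in>K. g * f \<in> J)" (is "_ \<longleftrightarrow> ?P")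
proof
  assume "ideal J (ring_on K)"
  then interpret ideal J "ring_on K" .
  show ?P
    using a_subset I_l_closed additive_subgroup.a_closed[OF is_additive_subgroup]
      additive_subgroup.zero_closed[OF is_additive_subgroup] by auto
next
  assume P: ?P
  have inv: "- f \<in> J" if "f \<in> J" for f
    using P that subring_setD(3)[OF K subring_setD(1)[OF K]] by (metis mult_minus1)
  interpret cring "ring_on K" by (rule cring_ring_on[OF K])
  have "a_inv (ring_on K) f = - f" if "f \<in> K" for f
    using that by (intro minus_equality) (auto simp: subring_setD[OF K])
  then have minv: "inv\<^bsub>add_monoid (ring_on K)\<^esub> f \<in> J" if "f \<in> J" for f
    using inv[OF that] that P by (metis a_inv_def subsetD)
  have "subgroup J (add_monoid (ring_on K))"
    by (rule group.subgroupI[OF a_group]) (use P minv in auto)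
  then show "ideal J (ring_on K)"
    using P by (intro idealI) (auto simp: ring_axioms mult.commute)
qed

lemma ideal_ring_onD:
  assumes "subring_set K" "ideal J (ring_on K)"
  shows "J \<subseteq> K" "0 \<in> J" "f \<in> J \<Longrightarrow> g \<in> J \<Longrightarrow> f + g \<in> J" "f \<in> J \<Longrightarrow> g \<in> K \<Longrightarrow> g * f \<in> J"
    "f \<in> J \<Longrightarrow> g \<in> K \<Longrightarrow> f * g \<in> J" "f \<in> J \<Longrightarrow> - f \<in> J" "f \<in> J \<Longrightarrow> g \<in> J \<Longrightarrow> f - g \<in> J"
proof -
  note J = assms(2)[unfolded ideal_ring_on_iff[OF assms(1)]]
  show "J \<subseteq> K" "0 \<in> J" and add: "f \<in> J \<Longrightarrow> g \<in> J \<Longrightarrow> f + g \<in> J"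
    and mult: "f \<in> J \<Longrightarrow> g \<in> K \<Longrightarrow> g * f \<in> J" for f g
    using J by auto
  show "f \<in> J \<Longrightarrow> g \<in> K \<Longrightarrow> f * g \<in> J" using mult by (simp add: mult.commute)
  have inv: "- f \<in> J" if "f \<in> J" for f
    using mult[OF that, of "-1"] subring_setD(1,3)[OF assms(1)] by simp
  show "f \<in> J \<Longrightarrow> - f \<in> J" by (rule inv)
  show "f \<in> J \<Longrightarrow> g \<in> J \<Longrightarrow> f - g \<in> J" using add[OF _ inv, of f g] by simp
qed

lemma ideal_genideal_ring_on:
  assumes "subring_set K" "S \<subseteq> K"
  shows "ideal (Idl\<^bsub>ring_on K\<^esub> S) (ring_on K)"
proof -
  interpret cring "ring_on K" by (rule cring_ring_on[OF assms(1)])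
  show ?thesis by (rule genideal_ideal) (simp add: assms(2))
qed

lemma genideal_ring_on_subset_iff:
  assumes "subring_set K" "S \<subseteq> K" "ideal J (ring_on K)"
  shows "Idl\<^bsub>ring_on K\<^esub> S \<subseteq> J \<longleftrightarrow> S \<subseteq> J"
proof -
  interpret cring "ring_on K" by (rule cring_ring_on[OF assms(1)])
  show ?thesis by (rule Idl_subset_ideal[OF assms(3)]) (simp add: assms(2))
qed

lemma genideal_ring_on_superset: "subring_set K \<Longrightarrow> S \<subseteq> K \<Longrightarrow> S \<subseteq> Idl\<^bsub>ring_on K\<^esub> S"
  using genideal_ring_on_subset_iff ideal_genideal_ring_on by blast

text \<open>
  Explicit coefficients are what makes it possible to compare the ideals that the same three elements
  generate over two different carriers.
\<close>

lemma genideal_ring_on_three: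
  assumes K: "subring_set K" and abc: "a \<in> K" "b \<in> K" "c \<in> K"
  shows "Idl\<^bsub>ring_on K\<^esub> {a, b, c} = {u * a + v * b + w * c | u v w. u \<in> K \<and> v \<in> K \<and> w \<in> K}"
proof -
  define J where "J = {u * a + v * b + w * c | u v w. u \<in> K \<and> v \<in> K \<and> w \<in> K}"
  have mem: "f \<in> J \<longleftrightarrow> (\<exists>u v w. f = u * a + v * b + w * c \<and> u \<in> K \<and> v \<in> K \<and> w \<in> K)" for f
    by (simp add: J_def)
  have memI: "u * a + v * b + w * c \<in> J" if "u \<in> K" "v \<in> K" "w \<in> K" for u v w
    unfolding mem using that by blast
  have add: "f + g \<in> J" if f: "f \<in> J" and g: "g \<in> J" for f g
  proof -
    obtain u v w where f: "f = u * a + v * b + w * c" "u \<in> K" "v \<in> K" "w \<in> K"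
      using f unfolding mem by blast
    obtain u' v' w' where g: "g = u' * a + v' * b + w' * c" "u' \<in> K" "v' \<in> K" "w' \<in> K"
      using g unfolding mem by blast
    have "f + g = (u + u') * a + (v + v') * b + (w + w') * c"
      by (simp add: f g algebra_simps)
    also have "\<dots> \<in> J"
      by (intro memI subring_setD(4)[OF K] f(2-4) g(2-4))
    finally show ?thesis .
  qed
  have mult: "g * f \<in> J" if f: "f \<in> J" and g: "g \<in> K" for f g
  proof -
    obtain u v w where f: "f = u * a + v * b + w * c" "u \<in> K" "v \<in> K" "w \<in> K"
      using f unfolding mem by blast
    have "g * f = (g * u) * a + (g * v) * b + (g * w) * c"
      by (simp add: f algebra_simps)
    also have "\<dots> \<in> J"
      by (intro memI subring_setD(6)[OF K] f(2-4) g)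
    finally show ?thesis .
  qed
  have "J \<subseteq> K"
  proof
    fix f assume "f \<in> J"
    then obtain u v w where "f = u * a + v * b + w * c" "u \<in> K" "v \<in> K" "w \<in> K"
      unfolding mem by blast
    then show "f \<in> K" using abc subring_setD(4,6)[OF K] by metis
  qed
  moreover have "0 \<in> J" using memI[of 0 0 0] by (simp add: subring_setD[OF K])
  ultimately have "ideal J (ring_on K)"
    unfolding ideal_ring_on_iff[OF K] using add mult by blast
  moreover have "{a, b, c} \<subseteq> J"
    using memI[of 1 0 0] memI[of 0 1 0] memI[of 0 0 1] by (simp add: subring_setD[OF K])
  ultimately have "Idl\<^bsub>ring_on K\<^esub> {a, b, c} \<subseteq> J"
    using abc by (subst genideal_ring_on_subset_iff[OF K]) auto
  moreover have J: "ideal (Idl\<^bsub>ring_on K\<^esub> {a, b, c}) (ring_on K)"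
    using abc by (intro ideal_genideal_ring_on[OF K]) auto
  have "{a, b, c} \<subseteq> Idl\<^bsub>ring_on K\<^esub> {a, b, c}"
    using abc by (intro genideal_ring_on_superset[OF K]) auto
  then have "J \<subseteq> Idl\<^bsub>ring_on K\<^esub> {a, b, c}"
    by (auto simp: mem intro!: ideal_ring_onD(3,4)[OF K J])
  ultimately show ?thesis unfolding J_def by blast
qed

lemma coset_ring_on_eqI:
  assumes K: "subring_set K" and J: "ideal J (ring_on K)" and "f \<in> K" "g \<in> K" "f - g \<in> J"
  shows "J +>\<^bsub>ring_on K\<^esub> f = J +>\<^bsub>ring_on K\<^esub> g"
proof -
  interpret ideal J "ring_on K" by (rule J)
  have "f \<in> J +>\<^bsub>ring_on K\<^esub> g"
    unfolding a_r_coset_def' using assms(5) by (auto intro!: bexI[of _ "f - g"])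
  then show ?thesis using a_repr_independence'[of f g] assms(4) by auto
qed

section \<open>The subring of polynomials\<close>

definition poly_set :: "laurent set" where
  "poly_set = {f. \<forall>e\<in>Poly_Mapping.keys f. 0 \<le> fst e \<and> 0 \<le> snd e}"

lemma poly_set_iff: "f \<in> poly_set \<longleftrightarrow> (\<forall>e\<in>Poly_Mapping.keys f. 0 \<le> fst e \<and> 0 \<le> snd e)"
  by (simp add: poly_set_def)

text \<open>
  The set is introduced independently of the ring \<open>Poly_Qxy\<close> so that this equation does not mention
  its left-hand side again on the right.
\<close>

lemma Poly_Qxy_eq: "Poly_Qxy = ring_on poly_set"
proof -
  have "carrier Poly_Qxy = poly_set"
    by (auto simp: Poly_Qxy_def poly_set_def)
  then show ?thesis
    by (simp add: Poly_Qxy_def ring_on_def ring_of_type_algebra_def)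
qed

lemma Laurent_Qxy_eq: "Laurent_Qxy = ring_on UNIV"
  by (simp add: ring_on_def ring_of_type_algebra_def)

lemma subring_set_UNIV: "subring_set UNIV"
  by (simp add: subring_set_def)

lemma subring_set_poly_set: "subring_set poly_set"
  unfolding subring_set_def
proof (intro conjI ballI)
  show "1 \<in> poly_set" by (simp add: poly_set_iff zero_prod_def)
  fix f assume f: "f \<in> poly_set"
  then show "- f \<in> poly_set" by (auto simp: poly_set_iff in_keys_iff)
  fix g assume g: "g \<in> poly_set"
  show "f + g \<in> poly_set" using f g keys_add[of f g] by (fastforce simp: poly_set_iff)
  show "f * g \<in> poly_set" using f g keys_mult[of f g] by (fastforce simp: poly_set_iff)
qed

lemmas poly_set_simps = subring_setD[OF subring_set_poly_set]

lemma single_in_poly_set_iff: "Poly_Mapping.single e c \<in> poly_set \<longleftrightarrow> c = 0 \<or> 0 \<le> fst e \<and> 0 \<le> snd e"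
  by (auto simp: poly_set_iff)

section \<open>Fox derivatives\<close>

lemma group_ring_map_add: "group_ring_map \<phi> (p + q) = group_ring_map \<phi> p + group_ring_map \<phi> q"
  unfolding group_ring_map_def
  by (rule setsum_keys_plus_distrib) (simp_all add: single_add)

lemma group_ring_map_zero [simp]: "group_ring_map \<phi> 0 = 0"
  by (simp add: group_ring_map_def)

lemma group_ring_map_uminus: "group_ring_map \<phi> (- p) = - group_ring_map \<phi> p"
  by (metis add.right_inverse add_eq_0_iff group_ring_map_add group_ring_map_zero)

lemma group_ring_map_diff: "group_ring_map \<phi> (p - q) = group_ring_map \<phi> p - group_ring_map \<phi> q"
  by (metis diff_conv_add_uminus group_ring_map_add group_ring_map_uminus)

definition monomial_of :: "('a \<Rightarrow> int \<times> int) \<Rightarrow> 'a free_group \<Rightarrow> laurent" where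
  "monomial_of \<phi> u = Poly_Mapping.single (free_hom \<phi> u) 1"

lemma monomial_of_add: "monomial_of \<phi> (u + v) = monomial_of \<phi> u * monomial_of \<phi> v"
  by (simp add: monomial_of_def mult_single)

lemma monomial_of_zero: "monomial_of \<phi> 0 = 1"
  by (simp add: monomial_of_def)

lemma monomial_of_group_pow: "monomial_of \<phi> (group_pow u n) = monomial_of \<phi> u ^ n"
  by (induction n) (simp_all add: group_pow_def monomial_of_add monomial_of_zero)

lemma group_ring_map_single: "group_ring_map \<phi> (Poly_Mapping.single u 1) = monomial_of \<phi> u"
  by (simp add: group_ring_map_def monomial_of_def)

text \<open>
  The left factor in the product rule \<open>\<partial>(uv) = \<partial>u + u \<partial>v\<close> is always a group element, so this
  much multiplicativity carries the rule over to the Laurent ring.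
\<close>

lemma group_ring_map_single_mult:
  "group_ring_map \<phi> (Poly_Mapping.single u 1 * p) = monomial_of \<phi> u * group_ring_map \<phi> p"
  by (rule frag_induction[of p UNIV])
    (simp_all add: mult_single group_ring_map_single monomial_of_add right_diff_distrib group_ring_map_diff)

definition fox_value :: "(nat \<Rightarrow> int \<times> int) \<Rightarrow> nat \<Rightarrow> nat free_group \<Rightarrow> laurent" where
  "fox_value \<phi> j u = group_ring_map \<phi> (fox j u)"

lemma fox_value_gen: "fox_value \<phi> j (free_gen x) = (if x = j then 1 else 0)"
  using group_ring_map_single[of \<phi> 0]
  by (simp add: fox_value_def fox_gen monomial_of_zero)

lemma fox_value_zero: "fox_value \<phi> j 0 = 0"
  by (simp add: fox_value_def fox_zero)

lemma fox_value_add: "fox_value \<phi> j (u + v) = fox_value \<phi> j u + monomial_of \<phi> u * fox_value \<phi> j v"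
  by (simp add: fox_value_def fox_add group_ring_map_add group_ring_map_single_mult)

lemma fox_value_uminus: "fox_value \<phi> j (- u) = - (monomial_of \<phi> (- u) * fox_value \<phi> j u)"
  using fox_value_add[of \<phi> j "- u" u] by (simp add: fox_value_zero eq_neg_iff_add_eq_0)

lemma fox_value_group_pow:
  "fox_value \<phi> j (group_pow u n) = (\<Sum>i<n. monomial_of \<phi> u ^ i) * fox_value \<phi> j u"
  by (induction n) (simp_all add: group_pow_def fox_value_zero fox_value_add algebra_simps
      sum.lessThan_Suc_shift sum_distrib_left sum_distrib_right del: sum.lessThan_Suc)

text \<open>
  The product rule gives \<open>\<partial>u + u \<partial>v - u v u\<inverse> \<partial>u\<close>, and in the commutative ring \<open>u v u\<inverse>\<close> and \<open>v\<close>
  have the same image.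
\<close>

lemma fox_value_conj:
  "fox_value \<phi> j (u + v - u) = (1 - monomial_of \<phi> v) * fox_value \<phi> j u + monomial_of \<phi> u * fox_value \<phi> j v"
proof -
  have "monomial_of \<phi> u * monomial_of \<phi> (- u) = 1"
    by (metis monomial_of_add monomial_of_zero right_minus)
  then have "monomial_of \<phi> (u + v) * monomial_of \<phi> (- u) = monomial_of \<phi> v"
    by (simp add: monomial_of_add ac_simps)
  moreover have "fox_value \<phi> j (u + v - u) = fox_value \<phi> j u + monomial_of \<phi> u * fox_value \<phi> j v
      - monomial_of \<phi> (u + v) * monomial_of \<phi> (- u) * fox_value \<phi> j u"
    by (simp only: diff_conv_add_uminus fox_value_add fox_value_uminus) (simp add: algebra_simps)
  ultimately show ?thesis by (simp add: algebra_simps)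
qed

lemma monomial_of_conj: "monomial_of \<phi> (u + v - u) = monomial_of \<phi> v"
  by (simp add: monomial_of_def)

lemma group_pow_Suc: "group_pow u (Suc n) = u + group_pow u n"
  by (simp add: group_pow_def)

lemma group_pow_Suc_right: "group_pow u (Suc n) = group_pow u n + u"
proof (induction n)
  case (Suc n)
  have "group_pow u (Suc (Suc n)) = u + (group_pow u n + u)"
    by (simp only: group_pow_Suc[of u "Suc n"] Suc)
  then show ?case by (simp only: group_pow_Suc[of u n] add.assoc)
qed (simp add: group_pow_def)

lemma group_pow_uminus: "group_pow (- u) n = - group_pow u n"
proof (induction n)
  case (Suc n)
  have "group_pow (- u) (Suc n) = - u + - group_pow u n"
    by (simp only: group_pow_Suc Suc)
  also have "\<dots> = - group_pow u (Suc n)"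
    by (simp only: group_pow_Suc_right minus_add)
  finally show ?case .
qed (simp add: group_pow_def)

section \<open>The Fox matrix of the pretzel link\<close>

definition laurent_x_inv :: laurent where "laurent_x_inv = Poly_Mapping.single (0, - 1) 1"

lemma laurent_x_inv: "laurent_x * laurent_x_inv = 1"
  by (simp add: laurent_x_def laurent_x_inv_def mult_single flip: zero_prod_def)

lemma monomial_of_gens:
  "monomial_of pretzel_phi (free_gen 0) = laurent_y"
  "monomial_of pretzel_phi (free_gen (Suc 0)) = laurent_x"
  "monomial_of pretzel_phi (free_gen 2) = laurent_x"
  "monomial_of pretzel_phi (- free_gen (Suc 0)) = laurent_x_inv"
  "monomial_of pretzel_phi (- free_gen 2) = laurent_x_inv"
  by (simp_all add: monomial_of_def pretzel_phi_def laurent_x_def laurent_y_def laurent_x_inv_def)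

lemma G_poly_mult: "G_poly k * (1 - laurent_x * laurent_y) = 1 - (laurent_x * laurent_y) ^ k"
  unfolding G_poly_eq_sum
  using one_diff_power_eq[of "laurent_x * laurent_y" k] by (simp add: mult.commute)

lemma H_poly_mult: "H_poly m * (laurent_x - laurent_y) = laurent_x ^ m - laurent_y ^ m"
  unfolding H_poly_eq_sum
  using power_diff_sumr2[of laurent_x m laurent_y] by (simp add: mult.commute)

text \<open>
  Pairing the terms of the alternating sum after the first gives a congruence of \<open>A\<close> with 1 modulo
  \<open>1 - x\<close>.  The sum of even powers that appears is also the one in the Fox derivatives of
  powers of \<open>cb\<close>, because \<open>cb\<close> is mapped to \<open>x\<^sup>2\<close>.
\<close>

lemma A_poly_eq_geometric:
  "A_poly (2 * n + 1) = 1 + (laurent_x - 1) * laurent_x * (\<Sum>i<n. (laurent_x * laurent_x) ^ i)"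
proof -
  have "(\<Sum>i<2 * n + 1. (- laurent_x) ^ i)
    = 1 + (laurent_x - 1) * laurent_x * (\<Sum>i<n. (laurent_x * laurent_x) ^ i)"
  proof (induction n)
    case (Suc n)
    have "(\<Sum>i<2 * Suc n + 1. (- laurent_x) ^ i) = (\<Sum>i<2 * n + 1. (- laurent_x) ^ i)
        - laurent_x ^ (2 * n) * laurent_x + laurent_x ^ (2 * n) * laurent_x * laurent_x"
      by (simp add: algebra_simps)
    then show ?case unfolding Suc
      by (simp add: power_mult power2_eq_square algebra_simps)
  qed simp
  then show ?thesis by (simp add: A_poly_eq_sum)
qed

text \<open>
  The sum comes from the derivative of \<open>(ac\<inverse>)\<^sup>m\<close>, whose base is mapped to \<open>y / x\<close>;
  it is \<open>H\<close> up to a power of \<open>x\<close>.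
\<close>

lemma sum_powers_y_div_x:
  assumes "m \<ge> 1"
  shows "laurent_x_inv * (\<Sum>i<m. (laurent_y * laurent_x_inv) ^ i) = laurent_x_inv ^ m * H_poly m"
proof -
  have "(laurent_y * laurent_x_inv) ^ i * laurent_x_inv
      = laurent_x_inv ^ m * (laurent_y ^ i * laurent_x ^ (m - Suc i))" if "i < m" for i
  proof -
    have 1: "laurent_x_inv ^ m = laurent_x_inv ^ Suc i * laurent_x_inv ^ (m - Suc i)"
      using that by (metis Suc_leI le_add_diff_inverse power_add)
    have 2: "laurent_x ^ (m - Suc i) * laurent_x_inv ^ (m - Suc i) = 1"
      by (simp add: laurent_x_inv flip: power_mult_distrib)
    have "(laurent_y * laurent_x_inv) ^ i * laurent_x_inv = laurent_y ^ i * laurent_x_inv ^ Suc i"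
      by (simp only: power_mult_distrib power_Suc ac_simps)
    also have "\<dots> = laurent_y ^ i * laurent_x_inv ^ Suc i * (laurent_x ^ (m - Suc i) * laurent_x_inv ^ (m - Suc i))"
      by (simp only: 2 mult_1_right)
    also have "\<dots> = laurent_x_inv ^ m * (laurent_y ^ i * laurent_x ^ (m - Suc i))"
      by (simp only: 1 ac_simps)
    finally show ?thesis .
  qed
  then have "laurent_x_inv * (\<Sum>i<m. (laurent_y * laurent_x_inv) ^ i)
      = laurent_x_inv ^ m * (\<Sum>i<m. laurent_y ^ i * laurent_x ^ (m - Suc i))"
    by (simp add: sum_distrib_left mult.commute[of laurent_x_inv])
  also have "(\<Sum>i<m. laurent_y ^ i * laurent_x ^ (m - Suc i)) = H_poly m"
    unfolding H_poly_eq_sum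
    by (subst sum.nat_diff_reindex[symmetric]) (auto intro!: sum.cong)
  finally show ?thesis .
qed

text \<open>
  The first row of the Fox matrix, for \<open>r = n + 1\<close> and \<open>q = 2 n + 1\<close>.  The relator is the conjugate of
  \<open>b\<inverse>\<close> by \<open>(cb)\<^sup>r\<close> times the conjugate of \<open>c\<close> by \<open>(ac\<inverse>)\<^sup>m\<close>.
\<close>

lemma fox_relator1:
  fixes m n :: nat
  assumes "m \<ge> 1"
  defines "a \<equiv> free_gen (0::nat)" and "b \<equiv> free_gen 1" and "c \<equiv> free_gen 2"
  defines "r1 \<equiv> group_pow (c + b) (Suc n) - b - group_pow (c + b) (Suc n)
    + group_pow (a - c) m + c + group_pow (c - a) m"
  shows "fox_value pretzel_phi 0 r1 = laurent_x_inv ^ m * (1 - laurent_x) * H_poly m"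
    and "fox_value pretzel_phi 1 r1 = - A_poly (2 * n + 1)"
    and "fox_value pretzel_phi 2 r1 = A_poly (2 * n + 1) - laurent_x_inv ^ m * (1 - laurent_y) * H_poly m"
proof -
  define S where "S = (\<Sum>i<n. (laurent_x * laurent_x) ^ i)"
  define T where "T = (\<Sum>i<m. (laurent_y * laurent_x_inv) ^ i)"
  define P where "P = (laurent_x * laurent_x) ^ n"
  define Q where "Q = (laurent_y * laurent_x_inv) ^ m"
  have S: "S * (1 - laurent_x * laurent_x) = 1 - P"
    unfolding S_def P_def using one_diff_power_eq[of "laurent_x * laurent_x" n] by (simp add: mult.commute)
  have T: "T * (1 - laurent_y * laurent_x_inv) = 1 - Q"
    unfolding T_def Q_def
    using one_diff_power_eq[of "laurent_y * laurent_x_inv" m] by (simp add: mult.commute)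
  have A: "A_poly (2 * n + 1) = 1 + (laurent_x - 1) * laurent_x * S"
    by (simp only: A_poly_eq_geometric S_def)
  have H: "laurent_x_inv ^ m * H_poly m = laurent_x_inv * T"
    using sum_powers_y_div_x[OF assms(1)] by (simp add: T_def)
  have H': "laurent_x_inv ^ m * p * H_poly m = p * (laurent_x_inv * T)" for p
    by (metis H mult.assoc mult.commute)
  have "r1 = (group_pow (c + b) (Suc n) + - b - group_pow (c + b) (Suc n))
      + (group_pow (a - c) m + c - group_pow (a - c) m)"
  proof -
    have "group_pow (c - a) m = - group_pow (a - c) m"
      by (simp flip: group_pow_uminus)
    then show ?thesis by (simp only: r1_def diff_conv_add_uminus add.assoc)
  qed
  \<comment> \<open>\<open>S + P\<close> is the sum of the first \<open>n + 1\<close> powers of \<open>x\<^sup>2\<close>, and \<open>P x\<^sup>2\<close> is the image of \<open>(cb)\<^sup>r\<close>.\<close>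
  then have row: "fox_value pretzel_phi j r1 =
      (1 - laurent_x_inv) * ((S + P) * (fox_value pretzel_phi j c + laurent_x * fox_value pretzel_phi j b))
        - P * laurent_x * laurent_x * laurent_x_inv * fox_value pretzel_phi j b
      + laurent_x_inv * ((1 - laurent_x) *
          (T * (fox_value pretzel_phi j a - laurent_y * laurent_x_inv * fox_value pretzel_phi j c))
          + Q * fox_value pretzel_phi j c)" for j
    by (simp only: fox_value_add monomial_of_conj fox_value_conj)
      (simp add: fox_value_group_pow fox_value_add fox_value_uminus monomial_of_add monomial_of_group_pow
        a_def b_def c_def monomial_of_gens S_def T_def P_def Q_def
        diff_conv_add_uminus[of "free_gen 0" "free_gen 2"] del: add_uminus_conv_diff)
  have gens: "fox_value pretzel_phi 0 a = 1" "fox_value pretzel_phi 0 b = 0" "fox_value pretzel_phi 0 c = 0"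
    "fox_value pretzel_phi 1 a = 0" "fox_value pretzel_phi 1 b = 1" "fox_value pretzel_phi 1 c = 0"
    "fox_value pretzel_phi 2 a = 0" "fox_value pretzel_phi 2 b = 0" "fox_value pretzel_phi 2 c = 1"
    by (simp_all add: a_def b_def c_def fox_value_gen)
  show "fox_value pretzel_phi 0 r1 = laurent_x_inv ^ m * (1 - laurent_x) * H_poly m"
    unfolding row gens H' by (simp add: algebra_simps)
  show "fox_value pretzel_phi 1 r1 = - A_poly (2 * n + 1)"
    unfolding row gens A using S laurent_x_inv by Groebner_Basis.algebra
  show "fox_value pretzel_phi 2 r1 = A_poly (2 * n + 1) - laurent_x_inv ^ m * (1 - laurent_y) * H_poly m"
    unfolding row gens A H' using S T laurent_x_inv by Groebner_Basis.algebra
qed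

text \<open>
  The second row.  The relator is the conjugate of \<open>b\<close> by \<open>(ab)\<^sup>-\<^sup>k\<close> times the conjugate of \<open>c\<inverse>\<close>
  by \<open>(cb)\<^sup>r\<^sup>-\<^sup>1\<close>; the element \<open>w\<close> is the image of \<open>(ab)\<^sup>-\<^sup>k\<close>.
\<close>

lemma fox_relator2:
  fixes k n :: nat
  defines "a \<equiv> free_gen (0::nat)" and "b \<equiv> free_gen 1" and "c \<equiv> free_gen 2"
  defines "r2 \<equiv> - group_pow (a + b) k + b + group_pow (a + b) k
    + group_pow (c + b) n - c - group_pow (c + b) n"
  obtains w where "w * (laurent_x * laurent_y) ^ k = 1"
    and "fox_value pretzel_phi 0 r2 = w * (laurent_x - 1) * G_poly k"
    and "fox_value pretzel_phi 1 r2 = A_poly (2 * n + 1) + w * (1 - laurent_y) * G_poly k"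
    and "fox_value pretzel_phi 2 r2 = - A_poly (2 * n + 1)"
proof
  define w where "w = monomial_of pretzel_phi (- group_pow (a + b) k)"
  define M where "M = (laurent_x * laurent_y) ^ k"
  define S where "S = (\<Sum>i<n. (laurent_x * laurent_x) ^ i)"
  define P where "P = (laurent_x * laurent_x) ^ n"
  have S: "S * (1 - laurent_x * laurent_x) = 1 - P"
    unfolding S_def P_def using one_diff_power_eq[of "laurent_x * laurent_x" n] by (simp add: mult.commute)
  have A: "A_poly (2 * n + 1) = 1 + (laurent_x - 1) * laurent_x * S"
    by (simp only: A_poly_eq_geometric S_def)
  have G: "G_poly k * (1 - laurent_x * laurent_y) = 1 - M"
    unfolding M_def by (rule G_poly_mult)
  have ab: "monomial_of pretzel_phi (a + b) = laurent_x * laurent_y"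
    by (simp add: monomial_of_add a_def b_def monomial_of_gens mult.commute)
  have "w * monomial_of pretzel_phi (group_pow (a + b) k) = 1"
    by (simp add: w_def monomial_of_zero flip: monomial_of_add)
  then have w: "w * M = 1"
    by (simp add: monomial_of_group_pow ab M_def)
  then show "w * (laurent_x * laurent_y) ^ k = 1" by (simp add: M_def)
  have "r2 = (- group_pow (a + b) k + b - (- group_pow (a + b) k))
      + (group_pow (c + b) n + - c - group_pow (c + b) n)"
    by (simp only: r2_def diff_conv_add_uminus minus_minus add.assoc)
  then have row: "fox_value pretzel_phi j r2 =
      - ((1 - laurent_x) * (w * (G_poly k * (fox_value pretzel_phi j a + laurent_y * fox_value pretzel_phi j b))))
        + w * fox_value pretzel_phi j b
      + laurent_x * ((1 - laurent_x_inv) *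
          (S * (fox_value pretzel_phi j c + laurent_x * fox_value pretzel_phi j b))
          - P * laurent_x_inv * fox_value pretzel_phi j c)" for j
    by (simp only: fox_value_add monomial_of_conj fox_value_conj)
      (simp add: fox_value_group_pow fox_value_add fox_value_uminus ab G_poly_eq_sum flip: w_def,
       simp add: monomial_of_add monomial_of_group_pow
        a_def b_def c_def monomial_of_gens S_def P_def)
  have gens: "fox_value pretzel_phi 0 a = 1" "fox_value pretzel_phi 0 b = 0" "fox_value pretzel_phi 0 c = 0"
    "fox_value pretzel_phi 1 a = 0" "fox_value pretzel_phi 1 b = 1" "fox_value pretzel_phi 1 c = 0"
    "fox_value pretzel_phi 2 a = 0" "fox_value pretzel_phi 2 b = 0" "fox_value pretzel_phi 2 c = 1"
    by (simp_all add: a_def b_def c_def fox_value_gen)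
  show "fox_value pretzel_phi 0 r2 = w * (laurent_x - 1) * G_poly k"
    unfolding row gens by (simp add: algebra_simps)
  show "fox_value pretzel_phi 1 r2 = A_poly (2 * n + 1) + w * (1 - laurent_y) * G_poly k"
    unfolding row gens A using G w laurent_x_inv by Groebner_Basis.algebra
  show "fox_value pretzel_phi 2 r2 = - A_poly (2 * n + 1)"
    unfolding row gens A using S laurent_x_inv by Groebner_Basis.algebra
qed

section \<open>The second elementary ideal\<close>

lemma minors_one: "minors 1 M = {M $$ (i, j) | i j. i < dim_row M \<and> j < dim_col M}"
proof -
  have det: "det (submatrix M {i} {j}) = M $$ (i, j)" if "i < dim_row M" "j < dim_col M" for i j
  proof -
    have card: "{i'. i' < dim_row M \<and> i' \<in> {i}} = {i}" "{j'. j' < dim_col M \<and> j' \<in> {j}} = {j}"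
      using that by auto
    have "submatrix M {i} {j} = mat 1 1 (\<lambda>(i', j'). M $$ (pick {i} i', pick {j} j'))"
      unfolding submatrix_def card by simp
    moreover have "pick {i} 0 = i" "pick {j} 0 = j"
      by (auto intro: Least_equality)
    ultimately show ?thesis by (simp add: det_single)
  qed
  show ?thesis
  proof
    show "minors 1 M \<subseteq> {M $$ (i, j) | i j. i < dim_row M \<and> j < dim_col M}"
      unfolding minors_def using det by (fastforce simp: card_1_singleton_iff)
    show "{M $$ (i, j) | i j. i < dim_row M \<and> j < dim_col M} \<subseteq> minors 1 M"
    proof clarify
      fix i j assume "i < dim_row M" "j < dim_col M"
      then show "M $$ (i, j) \<in> minors 1 M"
        unfolding minors_def by (intro CollectI exI[of _ "{i}"] exI[of _ "{j}"]) (auto simp: det)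
    qed
  qed
qed

text \<open>
  The inclusion of \<open>G\<close> and \<open>H\<close> in the ideal of the matrix entries uses the first column only: its
  entries are units times \<open>(1 - x) H\<close> and \<open>(1 - x) G\<close>, and \<open>1 - x\<close> is invertible modulo \<open>A\<close>.
\<close>

lemma pretzel_elementary_ideal_2:
  assumes "m \<ge> 1" "r \<ge> 1"
  shows "pretzel_elementary_ideal 2 k r m = Idl\<^bsub>ring_on UNIV\<^esub> {A_poly (2 * r - 1), G_poly k, H_poly m}"
proof -
  obtain n where n: "r = Suc n" using assms(2) by (cases r) auto
  define P where "P = pretzel_presentation k r m"
  define D where "D i j = fox_value pretzel_phi j (relators P ! i)" for i j
  have P: "num_gens P = 3" "length (relators P) = 2"
    by (simp_all add: P_def pretzel_presentation_def Let_def)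
  have "minors 1 (fox_matrix P pretzel_phi) = {D i j | i j. i < 2 \<and> j < 3}"
    unfolding minors_one
    by (intro Collect_cong ex_cong1) (auto simp: fox_matrix_def P D_def fox_value_def)
  also have "\<dots> = {D 0 0, D 0 1, D 0 2, D 1 0, D 1 1, D 1 2}"
    by (force simp: less_Suc_eq numeral_2_eq_2 numeral_3_eq_3)
  finally have minors: "minors (num_gens P - 2) (fox_matrix P pretzel_phi) = \<dots>"
    by (simp add: P)
  define A where "A = A_poly (2 * n + 1)"
  define G where "G = G_poly k"
  define H where "H = H_poly m"
  have row1: "D 0 0 = laurent_x_inv ^ m * (1 - laurent_x) * H" "D 0 1 = - A"
    "D 0 2 = A - laurent_x_inv ^ m * (1 - laurent_y) * H"
    using fox_relator1[OF assms(1), of n]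
    by (simp_all add: D_def P_def n pretzel_presentation_def Let_def A_def H_def)
  obtain w where w: "w * (laurent_x * laurent_y) ^ k = 1"
    and row2: "D 1 0 = w * (laurent_x - 1) * G" "D 1 1 = A + w * (1 - laurent_y) * G" "D 1 2 = - A"
    using fox_relator2[of k n]
    by (simp add: D_def P_def n pretzel_presentation_def Let_def A_def G_def) metis
  have "Idl\<^bsub>ring_on UNIV\<^esub> {D 0 0, D 0 1, D 0 2, D 1 0, D 1 1, D 1 2} = Idl\<^bsub>ring_on UNIV\<^esub> {A, G, H}"
  proof
    define J where "J = Idl\<^bsub>ring_on UNIV\<^esub> {A, G, H}"
    have J: "ideal J (ring_on UNIV)"
      unfolding J_def by (rule ideal_genideal_ring_on[OF subring_set_UNIV]) simp
    have "{A, G, H} \<subseteq> J"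
      unfolding J_def by (rule genideal_ring_on_superset[OF subring_set_UNIV]) simp
    then have "p * A \<in> J" "p * G \<in> J" "p * H \<in> J" "A \<in> J" for p
      using ideal_ring_onD(4)[OF subring_set_UNIV J] by auto
    then have "{D 0 0, D 0 1, D 0 2, D 1 0, D 1 1, D 1 2} \<subseteq> J"
      using ideal_ring_onD(3,6,7)[OF subring_set_UNIV J] unfolding row1 row2 by simp
    then show "Idl\<^bsub>ring_on UNIV\<^esub> {D 0 0, D 0 1, D 0 2, D 1 0, D 1 1, D 1 2} \<subseteq> J"
      by (subst genideal_ring_on_subset_iff[OF subring_set_UNIV _ J]) auto
  next
    define J where "J = Idl\<^bsub>ring_on UNIV\<^esub> {D 0 0, D 0 1, D 0 2, D 1 0, D 1 1, D 1 2}"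
    have J: "ideal J (ring_on UNIV)"
      unfolding J_def by (rule ideal_genideal_ring_on[OF subring_set_UNIV]) simp
    note closed = ideal_ring_onD[OF subring_set_UNIV J]
    have D: "D 0 0 \<in> J" "D 0 1 \<in> J" "D 1 0 \<in> J"
      using genideal_ring_on_superset[OF subring_set_UNIV, of "{D 0 0, D 0 1, D 0 2, D 1 0, D 1 1, D 1 2}"]
      by (auto simp: J_def)
    have A: "A \<in> J"
      using closed(6)[OF D(2)] unfolding row1 by simp
    \<comment> \<open>Cancellation of \<open>1 - x\<close>: write \<open>1 = A + (1 - x) s\<close> and multiply by \<open>f\<close>.\<close>
    have mem: "f \<in> J" if "(1 - laurent_x) * f \<in> J" for f
    proof -
      have eq: "f = A * f + laurent_x * (\<Sum>i<n. (laurent_x * laurent_x) ^ i) * ((1 - laurent_x) * f)"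
        unfolding A_def A_poly_eq_geometric by (simp add: algebra_simps)
      have "A * f + laurent_x * (\<Sum>i<n. (laurent_x * laurent_x) ^ i) * ((1 - laurent_x) * f) \<in> J"
        by (intro closed(3) closed(4)[OF that] closed(5)[OF A] UNIV_I)
      with eq show ?thesis by simp
    qed
    have x_power_inv: "laurent_x ^ m * laurent_x_inv ^ m = 1"
      by (simp add: laurent_x_inv flip: power_mult_distrib)
    have "(1 - laurent_x) * H = (laurent_x ^ m * laurent_x_inv ^ m) * ((1 - laurent_x) * H)"
      by (simp only: x_power_inv mult_1_left)
    also have "\<dots> = laurent_x ^ m * D 0 0"
      unfolding row1 by (simp only: ac_simps)
    finally have "(1 - laurent_x) * H \<in> J"
      using closed(4)[OF D(1) UNIV_I, of "laurent_x ^ m"] by argo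
    then have "H \<in> J" by (rule mem)
    have "(1 - laurent_x) * G = (w * (laurent_x * laurent_y) ^ k) * ((1 - laurent_x) * G)"
      by (simp only: w mult_1_left)
    also have "\<dots> = - ((laurent_x * laurent_y) ^ k) * D 1 0"
      unfolding row2 by (simp add: algebra_simps)
    finally have "(1 - laurent_x) * G \<in> J"
      using closed(4)[OF D(3) UNIV_I, of "- ((laurent_x * laurent_y) ^ k)"] by argo
    then have "G \<in> J" by (rule mem)
    with \<open>H \<in> J\<close> have "{A, G, H} \<subseteq> J" using A by simp
    then show "Idl\<^bsub>ring_on UNIV\<^esub> {A, G, H} \<subseteq> J"
      by (subst genideal_ring_on_subset_iff[OF subring_set_UNIV _ J]) auto
  qed
  then show ?thesis
    unfolding elementary_ideal_def Laurent_Qxy_eq using minors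
    by (simp add: P_def A_def G_def H_def n)
qed

lemma A_G_H_in_poly_set:
  assumes "odd q"
  shows "A_poly q \<in> poly_set" "G_poly k \<in> poly_set" "H_poly m \<in> poly_set"
proof -
  have xy: "laurent_x \<in> poly_set" "laurent_y \<in> poly_set"
    by (simp_all add: laurent_x_def laurent_y_def single_in_poly_set_iff)
  then show "A_poly q \<in> poly_set" "G_poly k \<in> poly_set" "H_poly m \<in> poly_set"
    unfolding A_poly_eq_sum[OF assms] G_poly_eq_sum H_poly_eq_sum
    by (auto intro!: subring_set_sum subring_set_poly_set poly_set_simps)
qed

text \<open>
  A uniform threshold, rather than a single exponent, allows several Laurent polynomials to be cleared
  of denominators at once.
\<close>

lemma xy_power_mult_in_poly_set:
  fixes f :: laurent
  shows "\<exists>N. \<forall>n\<ge>N. (laurent_x * laurent_y) ^ n * f \<in> poly_set"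
proof -
  \<comment> \<open>Any bound for the absolute values of all exponents will do; a sum over the keys avoids the case \<open>f = 0\<close>.\<close>
  define N where "N = (\<Sum>e\<in>Poly_Mapping.keys f. nat \<bar>fst e\<bar> + nat \<bar>snd e\<bar>)"
  have xy: "(laurent_x * laurent_y) ^ n = Poly_Mapping.single (int n, int n) 1" for n
    by (induction n) (simp_all add: laurent_x_def laurent_y_def mult_single flip: zero_prod_def)
  have "(laurent_x * laurent_y) ^ n * f \<in> poly_set" if "n \<ge> N" for n
    unfolding poly_set_iff
  proof
    fix e assume "e \<in> Poly_Mapping.keys ((laurent_x * laurent_y) ^ n * f)"
    then obtain d where d: "d \<in> Poly_Mapping.keys f" "e = (int n, int n) + d"
      using keys_mult[of "(laurent_x * laurent_y) ^ n" f] by (auto simp: xy)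
    have "nat \<bar>fst d\<bar> + nat \<bar>snd d\<bar> \<le> N"
      unfolding N_def using d(1) by (intro member_le_sum) auto
    with that d(2) show "0 \<le> fst e \<and> 0 \<le> snd e" by (cases d) auto
  qed
  then show ?thesis by blast
qed

text \<open>
  If \<open>M = (xy)\<^sup>k\<close> is 1 modulo the polynomial ideal, then so is \<open>M\<^sup>n\<close>.  For a polynomial \<open>f\<close> in the Laurent
  ideal and \<open>n\<close> large, \<open>M\<^sup>n f\<close> is in the polynomial ideal, and so is
  \<open>f = (1 - M\<^sup>n) f + M\<^sup>n f\<close>.
\<close>

lemma laurent_ideal_contraction:
  assumes k: "k \<ge> 1" and abc: "a \<in> poly_set" "b \<in> poly_set" "c \<in> poly_set"
    and unit: "1 - (laurent_x * laurent_y) ^ k \<in> Idl\<^bsub>ring_on poly_set\<^esub> {a, b, c}"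
  shows "Idl\<^bsub>ring_on UNIV\<^esub> {a, b, c} \<inter> poly_set = Idl\<^bsub>ring_on poly_set\<^esub> {a, b, c}"
proof
  let ?J = "Idl\<^bsub>ring_on poly_set\<^esub> {a, b, c}"
  note P = subring_set_poly_set
  have J: "ideal ?J (ring_on poly_set)"
    using abc by (intro ideal_genideal_ring_on[OF P]) auto
  note closed = ideal_ring_onD[OF P J]
  have "?J \<subseteq> Idl\<^bsub>ring_on UNIV\<^esub> {a, b, c}"
    unfolding genideal_ring_on_three[OF P abc] genideal_ring_on_three[OF subring_set_UNIV UNIV_I UNIV_I UNIV_I]
    by blast
  then show "?J \<subseteq> Idl\<^bsub>ring_on UNIV\<^esub> {a, b, c} \<inter> poly_set"
    using closed(1) by blast
  show "Idl\<^bsub>ring_on UNIV\<^esub> {a, b, c} \<inter> poly_set \<subseteq> ?J"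
  proof
    fix f assume f: "f \<in> Idl\<^bsub>ring_on UNIV\<^esub> {a, b, c} \<inter> poly_set"
    then obtain u v w where uvw: "f = u * a + v * b + w * c"
      unfolding genideal_ring_on_three[OF subring_set_UNIV UNIV_I UNIV_I UNIV_I] by blast
    obtain N1 N2 N3 where N: "\<forall>n\<ge>N1. (laurent_x * laurent_y) ^ n * u \<in> poly_set"
      "\<forall>n\<ge>N2. (laurent_x * laurent_y) ^ n * v \<in> poly_set"
      "\<forall>n\<ge>N3. (laurent_x * laurent_y) ^ n * w \<in> poly_set"
      using xy_power_mult_in_poly_set by metis
    define n where "n = N1 + N2 + N3"
    define M where "M = (laurent_x * laurent_y) ^ k"
    have "n \<le> k * n" using k by simp
    moreover have "N1 \<le> n" "N2 \<le> n" "N3 \<le> n" by (simp_all add: n_def)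
    ultimately have "N1 \<le> k * n" "N2 \<le> k * n" "N3 \<le> k * n" by (blast intro: order_trans)+
    then have n: "M ^ n * u \<in> poly_set" "M ^ n * v \<in> poly_set" "M ^ n * w \<in> poly_set"
      using N by (auto simp: M_def simp flip: power_mult)
    have "M ^ n * f = (M ^ n * u) * a + (M ^ n * v) * b + (M ^ n * w) * c"
      unfolding uvw by (simp add: algebra_simps)
    then have 1: "M ^ n * f \<in> ?J"
      unfolding genideal_ring_on_three[OF P abc] using n by blast
    have M: "M \<in> poly_set"
      unfolding M_def by (auto simp: laurent_x_def laurent_y_def single_in_poly_set_iff intro!: poly_set_simps)
    have "(\<Sum>i<n. M ^ i) * (1 - M) \<in> ?J"
      using unit M by (intro closed(4) subring_set_sum[OF P] poly_set_simps) (auto simp: M_def)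
    then have "1 - M ^ n \<in> ?J"
      using one_diff_power_eq[of M n] by (simp add: mult.commute)
    then have "(1 - M ^ n) * f + M ^ n * f \<in> ?J"
      using f 1 by (intro closed(3)[OF closed(5)]) auto
    then show "f \<in> ?J" by (simp add: algebra_simps)
  qed
qed

section \<open>Leading terms\<close>

text \<open>
  Divisibility of monomials.  The order \<open>\<le>\<close> on exponents is the lexicographic one.
\<close>

definition exp_le :: "int \<times> int \<Rightarrow> int \<times> int \<Rightarrow> bool" (infix "\<preceq>" 50) where
  "d \<preceq> e \<longleftrightarrow> fst d \<le> fst e \<and> snd d \<le> snd e"

lemma exp_le_refl: "e \<preceq> e"
  by (simp add: exp_le_def)

lemma exp_le_trans: "c \<preceq> d \<Longrightarrow> d \<preceq> e \<Longrightarrow> c \<preceq> e"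
  by (auto simp: exp_le_def)

lemma exp_le_antisym: "d \<preceq> e \<Longrightarrow> e \<preceq> d \<Longrightarrow> d = e"
  by (auto simp: exp_le_def prod_eq_iff)

lemma exp_le_imp_le: "d \<preceq> e \<Longrightarrow> d \<le> e"
  by (cases d; cases e) (auto simp: exp_le_def)

lemma lex_exponent_in_keys: "f \<noteq> 0 \<Longrightarrow> lex_exponent f \<in> Poly_Mapping.keys f"
  unfolding lex_exponent_def by (rule Max_in) simp_all

lemma keys_le_lex_exponent: "e \<in> Poly_Mapping.keys f \<Longrightarrow> e \<le> lex_exponent f"
  unfolding lex_exponent_def by (rule Max_ge) simp_all

lemma lex_coeff_eq_0_iff: "lex_coeff f = 0 \<longleftrightarrow> f = 0"
  using lex_exponent_in_keys[of f] by (auto simp: lex_coeff_def in_keys_iff)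

lemma lex_exponent_eqI:
  assumes "e \<in> Poly_Mapping.keys f" "\<And>d. d \<in> Poly_Mapping.keys f \<Longrightarrow> d \<le> e"
  shows "lex_exponent f = e"
  unfolding lex_exponent_def using assms by (intro Max_eqI) auto

lemma lex_exponent_nonneg: "f \<in> poly_set \<Longrightarrow> f \<noteq> 0 \<Longrightarrow> (0, 0) \<preceq> lex_exponent f"
  using lex_exponent_in_keys by (auto simp: poly_set_iff exp_le_def)

lemma lookup_single_mult:
  fixes p :: laurent
  shows "Poly_Mapping.lookup (Poly_Mapping.single d c * p) (d + e) = c * Poly_Mapping.lookup p e"
  by (simp add: lookup_mult lookup_single when_mult)

lemma keys_single_mult:
  fixes p :: laurent
  shows "Poly_Mapping.keys (Poly_Mapping.single d c * p) \<subseteq> (+) d ` Poly_Mapping.keys p"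
proof
  fix e assume "e \<in> Poly_Mapping.keys (Poly_Mapping.single d c * p)"
  then obtain a b where "a \<in> Poly_Mapping.keys (Poly_Mapping.single d c)" "b \<in> Poly_Mapping.keys p" "e = a + b"
    using keys_mult by blast
  then show "e \<in> (+) d ` Poly_Mapping.keys p"
    by (cases "c = 0") simp_all
qed

section \<open>Ideals of leading terms\<close>

lemma lex_term_in_poly_set: "p \<in> poly_set \<Longrightarrow> lex_term p \<in> poly_set"
  using lex_exponent_nonneg[of p] lex_coeff_eq_0_iff[of p]
  by (auto simp: lex_term_def single_in_poly_set_iff exp_le_def)

text \<open>
  The polynomials all of whose monomials are divisible by a leading monomial from \<open>S\<close> form an ideal
  that contains the leading terms.
\<close>

lemma keys_in_genideal_lex_terms:
  assumes S: "S \<subseteq> poly_set - {0}" and f: "f \<in> Idl\<^bsub>ring_on poly_set\<^esub> (lex_term ` S)"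
    and e: "e \<in> Poly_Mapping.keys f"
  shows "\<exists>p\<in>S. lex_exponent p \<preceq> e"
proof -
  define J where "J = {f \<in> poly_set. \<forall>e\<in>Poly_Mapping.keys f. \<exists>p\<in>S. lex_exponent p \<preceq> e}"
  have "J \<subseteq> poly_set" "0 \<in> J"
    by (auto simp: J_def poly_set_simps)
  moreover have "f + g \<in> J" if "f \<in> J" "g \<in> J" for f g
    using that keys_add[of f g] by (fastforce simp: J_def poly_set_simps)
  moreover have "g * f \<in> J" if "f \<in> J" "g \<in> poly_set" for f g
  proof -
    have "\<exists>p\<in>S. lex_exponent p \<preceq> e" if e: "e \<in> Poly_Mapping.keys (g * f)" for e
    proof -
      obtain a b where ab: "a \<in> Poly_Mapping.keys g" "b \<in> Poly_Mapping.keys f" "e = a + b"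
        using e keys_mult by blast
      then have "b \<preceq> e"
        using \<open>g \<in> poly_set\<close> by (auto simp: poly_set_iff exp_le_def)
      moreover obtain p where "p \<in> S" "lex_exponent p \<preceq> b"
        using ab(2) \<open>f \<in> J\<close> unfolding J_def by blast
      ultimately show ?thesis using exp_le_trans by blast
    qed
    then show ?thesis using that by (simp add: J_def poly_set_simps)
  qed
  ultimately have J: "ideal J (ring_on poly_set)"
    unfolding ideal_ring_on_iff[OF subring_set_poly_set] by blast
  have terms: "lex_term ` S \<subseteq> poly_set"
    using S lex_term_in_poly_set by blast
  have "lex_term ` S \<subseteq> J"
  proof clarify
    fix p assume p: "p \<in> S"
    then have "lex_term p \<in> poly_set" using S lex_term_in_poly_set by blast
    moreover have "Poly_Mapping.keys (lex_term p) \<subseteq> {lex_exponent p}" by (simp add: lex_term_def)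
    ultimately show "lex_term p \<in> J" using p exp_le_refl unfolding J_def by blast
  qed
  then have "Idl\<^bsub>ring_on poly_set\<^esub> (lex_term ` S) \<subseteq> J"
    using genideal_ring_on_subset_iff[OF subring_set_poly_set terms J] by blast
  then show ?thesis using f e by (auto simp: J_def)
qed

lemma single_in_genideal_lex_terms:
  assumes S: "S \<subseteq> poly_set - {0}" and p: "p \<in> S" "lex_exponent p \<preceq> e"
  shows "Poly_Mapping.single e c \<in> Idl\<^bsub>ring_on poly_set\<^esub> (lex_term ` S)"
proof -
  have terms: "lex_term ` S \<subseteq> poly_set"
    using S lex_term_in_poly_set by blast
  have "lex_coeff p \<noteq> 0"
    using S p(1) lex_coeff_eq_0_iff by blast
  then have eq: "Poly_Mapping.single e c
      = Poly_Mapping.single (e - lex_exponent p) (c / lex_coeff p) * lex_term p"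
    by (simp add: lex_term_def mult_single)
  have "Poly_Mapping.single (e - lex_exponent p) (c / lex_coeff p) \<in> poly_set"
    using p(2) by (auto simp: single_in_poly_set_iff exp_le_def)
  moreover have "lex_term p \<in> Idl\<^bsub>ring_on poly_set\<^esub> (lex_term ` S)"
    using genideal_ring_on_superset[OF subring_set_poly_set terms] p(1) by blast
  ultimately show ?thesis unfolding eq
    by (intro ideal_ring_onD(4)[OF subring_set_poly_set ideal_genideal_ring_on[OF subring_set_poly_set terms]])
qed

lemma single_in_genideal_lex_terms_iff:
  assumes "S \<subseteq> poly_set - {0}"
  shows "Poly_Mapping.single e 1 \<in> Idl\<^bsub>ring_on poly_set\<^esub> (lex_term ` S) \<longleftrightarrow> (\<exists>p\<in>S. lex_exponent p \<preceq> e)"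
proof
  assume "Poly_Mapping.single e 1 \<in> Idl\<^bsub>ring_on poly_set\<^esub> (lex_term ` S)"
  then show "\<exists>p\<in>S. lex_exponent p \<preceq> e"
    by (rule keys_in_genideal_lex_terms[OF assms]) simp
qed (use single_in_genideal_lex_terms[OF assms] in blast)

lemma genideal_lex_terms_subset_iff:
  assumes S: "S \<subseteq> poly_set - {0}" and S': "S' \<subseteq> poly_set - {0}"
  shows "Idl\<^bsub>ring_on poly_set\<^esub> (lex_term ` S) \<subseteq> Idl\<^bsub>ring_on poly_set\<^esub> (lex_term ` S')
    \<longleftrightarrow> (\<forall>p\<in>S. \<exists>p'\<in>S'. lex_exponent p' \<preceq> lex_exponent p)"
proof -
  have terms: "lex_term ` S \<subseteq> poly_set" "lex_term ` S' \<subseteq> poly_set"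
    using S S' lex_term_in_poly_set by blast+
  have "lex_term p \<in> Idl\<^bsub>ring_on poly_set\<^esub> (lex_term ` S')
      \<longleftrightarrow> (\<exists>p'\<in>S'. lex_exponent p' \<preceq> lex_exponent p)" if "p \<in> S" for p
  proof -
    have "lex_exponent p \<in> Poly_Mapping.keys (lex_term p)"
      using that S lex_coeff_eq_0_iff[of p] by (auto simp: lex_term_def)
    moreover have "lex_term p \<in> Idl\<^bsub>ring_on poly_set\<^esub> (lex_term ` S')"
      if "p' \<in> S'" "lex_exponent p' \<preceq> lex_exponent p" for p'
      using single_in_genideal_lex_terms[OF S' that, of "lex_coeff p"] by (simp only: lex_term_def)
    ultimately show ?thesis
      using keys_in_genideal_lex_terms[OF S', of "lex_term p"] by blast
  qed
  then show ?thesis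
    unfolding genideal_ring_on_subset_iff[OF subring_set_poly_set terms(1)
        ideal_genideal_ring_on[OF subring_set_poly_set terms(2)]] by blast
qed

text \<open>
  For monomial ideals membership is divisibility by a generator, so the property of being a reduced
  Groebner basis is a statement about exponents and leading coefficients alone.
\<close>

lemma is_reduced_groebner_basis_iff:
  assumes I: "ideal I (ring_on poly_set)"
  shows "is_reduced_groebner_basis B I \<longleftrightarrow> finite B \<and> B \<subseteq> I - {0}
    \<and> (\<forall>f\<in>I - {0}. \<exists>p\<in>B. lex_exponent p \<preceq> lex_exponent f)
    \<and> (\<forall>p\<in>B. lex_coeff p = 1)
    \<and> (\<forall>p\<in>B. \<forall>e\<in>Poly_Mapping.keys p. \<forall>p'\<in>B - {p}. \<not> lex_exponent p' \<preceq> e)"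
proof -
  have subset: "I - {0} \<subseteq> poly_set - {0}"
    using ideal_ring_onD(1)[OF subring_set_poly_set I] by blast
  have nonzero: "0 \<notin> B" if "\<forall>p\<in>B. lex_coeff p = 1"
    using that lex_coeff_eq_0_iff[of 0] by force
  show ?thesis
  proof (cases "B \<subseteq> I - {0}")
    case True
    then have B: "B \<subseteq> poly_set - {0}" "B \<subseteq> I" using subset by blast+
    have "\<forall>p\<in>B. \<exists>f\<in>I - {0}. lex_exponent f \<preceq> lex_exponent p"
      using True exp_le_refl by blast
    then have groebner: "Idl\<^bsub>ring_on poly_set\<^esub> (lex_term ` B) = Idl\<^bsub>ring_on poly_set\<^esub> (lex_term ` (I - {0}))
        \<longleftrightarrow> (\<forall>f\<in>I - {0}. \<exists>p\<in>B. lex_exponent p \<preceq> lex_exponent f)"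
      unfolding set_eq_subset genideal_lex_terms_subset_iff[OF B(1) subset]
        genideal_lex_terms_subset_iff[OF subset B(1)] by blast
    have reduced: "Poly_Mapping.single e 1 \<notin> Idl\<^bsub>ring_on poly_set\<^esub> (lex_term ` (B - {p}))
        \<longleftrightarrow> (\<forall>p'\<in>B - {p}. \<not> lex_exponent p' \<preceq> e)" for e p
    proof -
      have "B - {p} \<subseteq> poly_set - {0}" using B(1) by blast
      from single_in_genideal_lex_terms_iff[OF this] show ?thesis by blast
    qed
    show ?thesis
      unfolding is_reduced_groebner_basis_def is_groebner_basis_def Poly_Qxy_eq groebner reduced
      by (simp only: True B(2) simp_thms conj_assoc)
  next
    case False
    then have "\<not> (B \<subseteq> I \<and> (\<forall>p\<in>B. lex_coeff p = 1))" using nonzero by blast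
    with False show ?thesis
      unfolding is_reduced_groebner_basis_def is_groebner_basis_def by argo
  qed
qed

section \<open>Existence and uniqueness of reduced Groebner bases\<close>

text \<open>
  Symmetric in the two bases, hence their equality.  Given \<open>p \<in> B\<close>, reducedness forces an element \<open>p'\<close>
  of \<open>B'\<close> whose leading exponent divides that of \<open>p\<close> to have the same leading exponent.  A nonzero difference \<open>p - p'\<close>
  would have a smaller leading exponent, occurring in \<open>p\<close> or in \<open>p'\<close>, and divisible by a leading exponent
  from either basis; this contradicts that \<open>B\<close> or \<open>B'\<close> is reduced.
\<close>

lemma reduced_groebner_basis_subset:
  assumes I: "ideal I (ring_on poly_set)"
    and B: "is_reduced_groebner_basis B I" and B': "is_reduced_groebner_basis B' I"
  shows "B \<subseteq> B'"
proof
  note B = B[unfolded is_reduced_groebner_basis_iff[OF I]]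
  note B' = B'[unfolded is_reduced_groebner_basis_iff[OF I]]
  note closed = ideal_ring_onD[OF subring_set_poly_set I]
  fix p assume p: "p \<in> B"
  have pI: "p \<in> I" "p \<noteq> 0" using p B by auto
  obtain p' where p': "p' \<in> B'" "lex_exponent p' \<preceq> lex_exponent p"
    using B' pI by blast
  have p'I: "p' \<in> I" "p' \<noteq> 0" using p' B' by auto
  obtain p'' where p'': "p'' \<in> B" "lex_exponent p'' \<preceq> lex_exponent p'"
    using B p'I by blast
  have "p'' = p"
    using B p p'' exp_le_trans[OF p''(2) p'(2)] lex_exponent_in_keys[OF pI(2)] by blast
  then have eq: "lex_exponent p' = lex_exponent p"
    using p'(2) p''(2) exp_le_antisym by blast
  have "p - p' = 0"
  proof (rule ccontr)
    assume nonzero: "p - p' \<noteq> 0"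
    define d where "d = lex_exponent (p - p')"
    have d: "d \<in> Poly_Mapping.keys (p - p')"
      unfolding d_def by (rule lex_exponent_in_keys[OF nonzero])
    have "Poly_Mapping.lookup (p - p') (lex_exponent p) = 0"
      using B B' p p'(1) eq by (auto simp: lookup_minus lex_coeff_def)
    then have neq: "d \<noteq> lex_exponent p"
      using d by (auto simp: in_keys_iff)
    have keys: "d \<in> Poly_Mapping.keys p \<or> d \<in> Poly_Mapping.keys p'"
      using d by (auto simp: in_keys_iff lookup_minus)
    then have "d \<le> lex_exponent p"
      using keys_le_lex_exponent[of d p] keys_le_lex_exponent[of d p'] eq by auto
    then have not_le: "\<not> lex_exponent p \<preceq> d"
      using neq exp_le_imp_le by (metis order_antisym)
    have I': "p - p' \<in> I - {0}" using closed(7)[OF pI(1) p'I(1)] nonzero by blast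
    obtain p1 where p1: "p1 \<in> B" "lex_exponent p1 \<preceq> d"
      using B I' unfolding d_def by blast
    obtain p1' where p1': "p1' \<in> B'" "lex_exponent p1' \<preceq> d"
      using B' I' unfolding d_def by blast
    show False
      using keys
    proof
      assume "d \<in> Poly_Mapping.keys p"
      then have "p1 = p" using B p p1 by blast
      then show False using p1(2) not_le by blast
    next
      assume "d \<in> Poly_Mapping.keys p'"
      then have "p1' = p'" using B' p'(1) p1' by blast
      then show False using p1'(2) not_le eq by simp
    qed
  qed
  then show "p \<in> B'" using p'(1) by simp
qed

text \<open>
  The two-dimensional case of Dickson's lemma.  With \<open>(a, b)\<close> one of the points, every point lies
  in one of the strips \<open>0 \<le> fst \<le> a\<close> and \<open>0 \<le> snd \<le> b\<close>; in an antichain each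
  coordinate determines the point, so both strips are finite.
\<close>

lemma finite_antichain_exp_le:
  assumes "\<And>e. e \<in> M \<Longrightarrow> (0, 0) \<preceq> e" and anti: "\<And>d e. d \<in> M \<Longrightarrow> e \<in> M \<Longrightarrow> d \<preceq> e \<Longrightarrow> d = e"
  shows "finite M"
proof (cases "M = {}")
  case False
  then obtain a b where ab: "(a, b) \<in> M" by auto
  have "M \<subseteq> {e \<in> M. fst e \<in> {0..a}} \<union> {e \<in> M. snd e \<in> {0..b}}"
  proof
    fix e assume e: "e \<in> M"
    have "fst e \<le> a \<or> snd e \<le> b"
    proof (cases "(a, b) \<preceq> e")
      case True
      then have "(a, b) = e" by (rule anti[OF ab e])
      then show ?thesis by auto
    qed (auto simp: exp_le_def)
    then show "e \<in> {e \<in> M. fst e \<in> {0..a}} \<union> {e \<in> M. snd e \<in> {0..b}}"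
      using e assms(1)[OF e] by (auto simp: exp_le_def)
  qed
  moreover have "finite {e \<in> M. fst e \<in> {0..a}}"
  proof (rule finite_imageD)
    show "finite (fst ` {e \<in> M. fst e \<in> {0..a}})"
      by (rule finite_subset[of _ "{0..a}"]) auto
    show "inj_on fst {e \<in> M. fst e \<in> {0..a}}"
    proof (rule inj_onI)
      fix d e assume "d \<in> {e \<in> M. fst e \<in> {0..a}}" "e \<in> {e \<in> M. fst e \<in> {0..a}}" "fst d = fst e"
      moreover from this have "d \<preceq> e \<or> e \<preceq> d" by (auto simp: exp_le_def)
      ultimately show "d = e" using anti by blast
    qed
  qed
  moreover have "finite {e \<in> M. snd e \<in> {0..b}}"
  proof (rule finite_imageD)
    show "finite (snd ` {e \<in> M. snd e \<in> {0..b}})"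
      by (rule finite_subset[of _ "{0..b}"]) auto
    show "inj_on snd {e \<in> M. snd e \<in> {0..b}}"
    proof (rule inj_onI)
      fix d e assume "d \<in> {e \<in> M. snd e \<in> {0..b}}" "e \<in> {e \<in> M. snd e \<in> {0..b}}" "snd d = snd e"
      moreover from this have "d \<preceq> e \<or> e \<preceq> d" by (auto simp: exp_le_def)
      ultimately show "d = e" using anti by blast
    qed
  qed
  ultimately show ?thesis by (meson finite_Un finite_subset)
qed simp

lemma exp_le_minimal_below:
  assumes nonneg: "\<And>e. e \<in> L \<Longrightarrow> (0, 0) \<preceq> e" and "e \<in> L"
  shows "\<exists>d\<in>L. d \<preceq> e \<and> (\<forall>c\<in>L. c \<preceq> d \<longrightarrow> c = d)"
  using \<open>e \<in> L\<close>
proof (induction "nat (fst e + snd e)" arbitrary: e rule: less_induct)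
  case less
  show ?case
  proof (cases "\<forall>c\<in>L. c \<preceq> e \<longrightarrow> c = e")
    case True
    then show ?thesis using less.prems exp_le_refl by blast
  next
    case False
    then obtain c where c: "c \<in> L" "c \<preceq> e" "c \<noteq> e" by blast
    then have "nat (fst c + snd c) < nat (fst e + snd e)"
      using nonneg[OF c(1)] by (auto simp: exp_le_def prod_eq_iff)
    then show ?thesis using less.hyps c exp_le_trans by blast
  qed
qed

text \<open>
  For an ideal this is the set of exponents of leading monomials of its nonzero elements.  It is closed
  upwards by definition; multiplication by monomials, which shows that the multiples also occur, is
  carried out in the reduction step below.
\<close>

definition leading_exponents :: "laurent set \<Rightarrow> (int \<times> int) set" where
  "leading_exponents I = {e. \<exists>p\<in>I - {0}. lex_exponent p \<preceq> e}"

text \<open>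
  The division algorithm, by induction on the bound \<open>e\<close> along the lexicographic order, which is
  well-founded on the quadrant.  The term of \<open>f\<close> at \<open>e\<close> is removed: if \<open>e\<close> is a leading exponent, by subtracting an
  element of the ideal, and otherwise by moving the term into the normal form.  Keeping the
  bound on the exponents of the result ensures that reducing a tail leaves the leading term alone.
\<close>

lemma normal_form_exists:
  assumes I: "ideal I (ring_on poly_set)" and "(0, 0) \<preceq> e"
    and "f \<in> poly_set" "\<And>d. d \<in> Poly_Mapping.keys f \<Longrightarrow> d \<le> e"
  shows "\<exists>g\<in>poly_set. f - g \<in> I \<and> (\<forall>d\<in>Poly_Mapping.keys g. d \<le> e \<and> d \<notin> leading_exponents I)"
proof -
  note closed = ideal_ring_onD[OF subring_set_poly_set I]
  have "wf (inv_image (less_than <*lex*> less_than) (\<lambda>e::int \<times> int. (nat (fst e), nat (snd e))))"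
    by auto
  then show ?thesis using assms(2-4)
  proof (induction e arbitrary: f rule: wf_induct_rule)
    case (less e)
    define c where "c = Poly_Mapping.lookup f e"
    \<comment> \<open>Both cases subtract some \<open>h\<close> with exponents at most \<open>e\<close> that agrees with \<open>f\<close> at \<open>e\<close>, after which
        the induction hypothesis applies to the leading exponent of the difference.\<close>
    have step: "\<exists>g\<in>poly_set. f - h - g \<in> I \<and> (\<forall>d\<in>Poly_Mapping.keys g. d \<le> e \<and> d \<notin> leading_exponents I)"
      if h: "h \<in> poly_set" "\<And>d. d \<in> Poly_Mapping.keys h \<Longrightarrow> d \<le> e" "Poly_Mapping.lookup h e = c" for h
    proof (cases "f - h = 0")
      case True
      then show ?thesis using closed(2) by (intro bexI[of _ 0]) (simp_all add: poly_set_simps)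
    next
      case False
      define e' where "e' = lex_exponent (f - h)"
      have fh: "f - h \<in> poly_set" using less.prems(2) h(1) by (rule poly_set_simps(5))
      have e': "e' \<in> Poly_Mapping.keys (f - h)"
        unfolding e'_def by (rule lex_exponent_in_keys[OF False])
      then have "e' \<in> Poly_Mapping.keys f \<or> e' \<in> Poly_Mapping.keys h"
        by (auto simp: in_keys_iff lookup_minus)
      moreover have "e' \<noteq> e"
        using e' h(3) by (auto simp: in_keys_iff lookup_minus c_def)
      ultimately have "e' < e" using less.prems(3)[of e'] h(2)[of e'] by (metis order_le_imp_less_or_eq)
      moreover have nonneg: "(0, 0) \<preceq> e'"
        unfolding e'_def by (rule lex_exponent_nonneg[OF fh False])
      ultimately have "(e', e) \<in> inv_image (less_than <*lex*> less_than) (\<lambda>e::int \<times> int. (nat (fst e), nat (snd e)))"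
        using less.prems(1) by (cases e; cases e') (auto simp: exp_le_def)
      from less.IH[OF this nonneg fh] keys_le_lex_exponent
      obtain g where "g \<in> poly_set" "f - h - g \<in> I"
        "\<forall>d\<in>Poly_Mapping.keys g. d \<le> e' \<and> d \<notin> leading_exponents I"
        unfolding e'_def by blast
      then show ?thesis using \<open>e' < e\<close> by (intro bexI[of _ g]) auto
    qed
    show ?case
    proof (cases "e \<in> leading_exponents I")
      case True
      then obtain p where p: "p \<in> I" "p \<noteq> 0" "lex_exponent p \<preceq> e"
        unfolding leading_exponents_def by blast
      define s where "s = Poly_Mapping.single (e - lex_exponent p) (c / lex_coeff p)"
      have s: "s \<in> poly_set"
        using p(3) by (auto simp: s_def single_in_poly_set_iff exp_le_def)
      have sp: "s * p \<in> I" by (rule closed(4)[OF p(1) s])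
      have "Poly_Mapping.lookup (s * p) (e - lex_exponent p + lex_exponent p) = c / lex_coeff p * lex_coeff p"
        unfolding s_def lookup_single_mult lex_coeff_def ..
      then have "Poly_Mapping.lookup (s * p) e = c"
        using lex_coeff_eq_0_iff[of p] p(2) by simp
      moreover have "d \<le> e" if d: "d \<in> Poly_Mapping.keys (s * p)" for d
      proof -
        obtain d' where d': "d' \<in> Poly_Mapping.keys p" "d = e - lex_exponent p + d'"
          using d keys_single_mult[of "e - lex_exponent p" "c / lex_coeff p" p] unfolding s_def by blast
        have "e - lex_exponent p + d' \<le> e - lex_exponent p + lex_exponent p"
          by (rule add_left_mono[OF keys_le_lex_exponent[OF d'(1)]])
        then show ?thesis using d'(2) by simp
      qed
      ultimately obtain g where g: "g \<in> poly_set" "f - s * p - g \<in> I"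
        "\<forall>d\<in>Poly_Mapping.keys g. d \<le> e \<and> d \<notin> leading_exponents I"
        using step[of "s * p"] sp closed(1) by blast
      have "f - g = (f - s * p - g) + s * p" by simp
      then have "f - g \<in> I" using closed(3)[OF g(2) sp] by simp
      then show ?thesis using g by blast
    next
      case False
      have single: "Poly_Mapping.single e c \<in> poly_set"
        using less.prems(1) by (auto simp: single_in_poly_set_iff exp_le_def)
      have keys: "Poly_Mapping.keys (Poly_Mapping.single e c) \<subseteq> {e}"
        by simp
      then have le: "d \<le> e" if "d \<in> Poly_Mapping.keys (Poly_Mapping.single e c)" for d
        using that by blast
      from step[OF single le lookup_single_eq] obtain g where g: "g \<in> poly_set"
        "f - Poly_Mapping.single e c - g \<in> I"
        "\<forall>d\<in>Poly_Mapping.keys g. d \<le> e \<and> d \<notin> leading_exponents I"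
        by blast
      have "f - (Poly_Mapping.single e c + g) \<in> I" using g(2) by (simp add: diff_diff_eq)
      moreover have "Poly_Mapping.single e c + g \<in> poly_set"
        using g(1) single by (intro poly_set_simps)
      moreover have "\<forall>d\<in>Poly_Mapping.keys (Poly_Mapping.single e c + g). d \<le> e \<and> d \<notin> leading_exponents I"
        using g(3) False keys keys_add[of "Poly_Mapping.single e c" g] order_refl[of e] by blast
      ultimately show ?thesis by blast
    qed
  qed
qed

text \<open>
  One element is chosen over every minimal leading exponent, made monic and with its tail
  in normal form.  A leading exponent that divided an exponent of another element would put
  that exponent among the leading ones, which leaves only the leading exponent of that element, and this is minimal.
\<close>

lemma reduced_groebner_basis_exists:
  assumes I: "ideal I (ring_on poly_set)"
  shows "\<exists>B. is_reduced_groebner_basis B I"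
proof -
  note closed = ideal_ring_onD[OF subring_set_poly_set I]
  let ?L = "leading_exponents I"
  have nonneg: "(0, 0) \<preceq> e" if "e \<in> ?L" for e
    using that lex_exponent_nonneg closed(1) exp_le_trans unfolding leading_exponents_def by blast
  have upward: "e \<in> ?L" if "d \<in> ?L" "d \<preceq> e" for d e
    using that exp_le_trans unfolding leading_exponents_def by blast
  define M where "M = {e \<in> ?L. \<forall>d\<in>?L. d \<preceq> e \<longrightarrow> d = e}"
  have "finite M"
    by (rule finite_antichain_exp_le) (auto simp: M_def nonneg)
  have "\<exists>p\<in>I. p \<noteq> 0 \<and> lex_exponent p = e \<and> lex_coeff p = 1
      \<and> (\<forall>d\<in>Poly_Mapping.keys p. d = e \<or> d \<notin> ?L)" if "e \<in> M" for e
  proof -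
    have e: "e \<in> ?L" using that by (simp add: M_def)
    then obtain p0 where p0: "p0 \<in> I" "p0 \<noteq> 0" "lex_exponent p0 \<preceq> e"
      unfolding leading_exponents_def by blast
    then have "lex_exponent p0 \<in> ?L"
      using exp_le_refl unfolding leading_exponents_def by blast
    then have lex: "lex_exponent p0 = e"
      using that p0(3) by (simp add: M_def)
    define p1 where "p1 = Poly_Mapping.single (0, 0) (1 / lex_coeff p0) * p0"
    have p1: "p1 \<in> I"
      unfolding p1_def using p0(1) by (intro closed(4)) (simp_all add: single_in_poly_set_iff)
    have "Poly_Mapping.lookup p1 ((0, 0) + e) = 1 / lex_coeff p0 * lex_coeff p0"
      unfolding p1_def lookup_single_mult lex_coeff_def lex ..
    then have lookup1: "Poly_Mapping.lookup p1 e = 1"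
      using p0(2) lex_coeff_eq_0_iff[of p0] by (simp flip: zero_prod_def)
    have "Poly_Mapping.keys p1 \<subseteq> Poly_Mapping.keys p0"
      using keys_single_mult[of "(0, 0)" "1 / lex_coeff p0" p0] by (simp add: p1_def flip: zero_prod_def)
    then have keys1: "d \<le> e" if "d \<in> Poly_Mapping.keys p1" for d
      using that keys_le_lex_exponent[of d p0] lex by blast
    let ?t = "Poly_Mapping.single e 1 :: laurent"
    have t: "?t \<in> poly_set"
      using nonneg[OF e] by (simp add: single_in_poly_set_iff exp_le_def)
    then have "p1 - ?t \<in> poly_set" using p1 closed(1) by (intro poly_set_simps) auto
    moreover have "d \<le> e" if "d \<in> Poly_Mapping.keys (p1 - ?t)" for d
    proof (cases "d = e")
      case False
      then have "d \<in> Poly_Mapping.keys p1"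
        using that by (simp add: in_keys_iff lookup_minus lookup_single when_def)
      then show ?thesis by (rule keys1)
    qed simp
    ultimately obtain g where g: "p1 - ?t - g \<in> I" "\<forall>d\<in>Poly_Mapping.keys g. d \<le> e \<and> d \<notin> ?L"
      using normal_form_exists[OF I nonneg[OF e]] by blast
    define p where "p = ?t + g"
    have "p = p1 - (p1 - ?t - g)" by (simp add: p_def)
    then have "p \<in> I" using closed(7)[OF p1 g(1)] by simp
    have "e \<notin> Poly_Mapping.keys g" using g(2) e by blast
    then have lookup: "Poly_Mapping.lookup p e = 1"
      by (simp add: p_def lookup_add in_keys_iff)
    have keys: "d = e \<or> d \<in> Poly_Mapping.keys g" if "d \<in> Poly_Mapping.keys p" for d
    proof -
      have "Poly_Mapping.keys ?t \<subseteq> {e}" by simp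
      then show ?thesis using that keys_add[of ?t g] unfolding p_def by blast
    qed
    have lexp: "lex_exponent p = e"
    proof (rule lex_exponent_eqI)
      show "e \<in> Poly_Mapping.keys p" using lookup by (simp add: in_keys_iff)
      show "d \<le> e" if "d \<in> Poly_Mapping.keys p" for d using keys[OF that] g(2) by auto
    qed
    then have "lex_coeff p = 1" using lookup by (simp add: lex_coeff_def)
    moreover have "p \<noteq> 0" using lookup by auto
    ultimately show ?thesis using \<open>p \<in> I\<close> lexp keys g(2) by blast
  qed
  then obtain b where b: "\<And>e. e \<in> M \<Longrightarrow> b e \<in> I \<and> b e \<noteq> 0 \<and> lex_exponent (b e) = e \<and> lex_coeff (b e) = 1
      \<and> (\<forall>d\<in>Poly_Mapping.keys (b e). d = e \<or> d \<notin> ?L)"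
    by metis
  have b: "b e \<in> I - {0}" "lex_exponent (b e) = e" "lex_coeff (b e) = 1"
    "\<And>d. d \<in> Poly_Mapping.keys (b e) \<Longrightarrow> d = e \<or> d \<notin> ?L" if "e \<in> M" for e
    using b[OF that] by blast+
  have "is_reduced_groebner_basis (b ` M) I"
    unfolding is_reduced_groebner_basis_iff[OF I]
  proof (intro conjI ballI)
    show "finite (b ` M)" using \<open>finite M\<close> by simp
    show "b ` M \<subseteq> I - {0}" by (rule image_subsetI) (rule b(1))
  next
    fix f assume "f \<in> I - {0}"
    then have "lex_exponent f \<in> ?L"
      using exp_le_refl unfolding leading_exponents_def by blast
    from exp_le_minimal_below[OF nonneg this] obtain d where d: "d \<in> M" "d \<preceq> lex_exponent f"
      unfolding M_def by blast
    then have "lex_exponent (b d) \<preceq> lex_exponent f" using b(2)[OF d(1)] by simp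
    then show "\<exists>p\<in>b ` M. lex_exponent p \<preceq> lex_exponent f" by (rule bexI) (rule imageI[OF d(1)])
  next
    fix p assume "p \<in> b ` M"
    then show "lex_coeff p = 1" by (elim imageE) (simp add: b(3))
  next
    fix p e p' assume p: "p \<in> b ` M" "e \<in> Poly_Mapping.keys p" "p' \<in> b ` M - {p}"
    from p(1) obtain d where d: "d \<in> M" "p = b d" by (rule imageE) auto
    from p(3) have "p' \<in> b ` M" "p' \<noteq> p" by simp_all
    from this(1) obtain d' where d': "d' \<in> M" "p' = b d'" by (rule imageE) auto
    have "d' \<noteq> d" using \<open>p' \<noteq> p\<close> d(2) d'(2) by blast
    show "\<not> lex_exponent p' \<preceq> e"
    proof
      assume "lex_exponent p' \<preceq> e"
      then have le: "d' \<preceq> e" using b(2)[OF d'(1)] d'(2) by simp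
      have "d' \<in> ?L" using d'(1) by (simp add: M_def)
      then have "e \<in> ?L" using upward le by blast
      then have "e = d" using b(4)[OF d(1), of e] d(2) p(2) by blast
      then show False using d(1) le \<open>d' \<in> ?L\<close> \<open>d' \<noteq> d\<close> by (simp add: M_def)
    qed
  qed
  then show ?thesis ..
qed

lemma reduced_groebner_basis_ex1:
  assumes "ideal I (ring_on poly_set)"
  shows "\<exists>!B. is_reduced_groebner_basis B I"
  using reduced_groebner_basis_exists[OF assms] reduced_groebner_basis_subset[OF assms] by blast

theorem proposition4p4:
  fixes k m r q :: nat and I :: "laurent set"
  assumes "k \<ge> 1" and "m \<ge> 1" and "r \<ge> 1"
    and "q = 2 * r - 1"
    and "I = pretzel_elementary_ideal 2 k r m \<inter> carrier Poly_Qxy"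
  shows "I = Idl\<^bsub>Poly_Qxy\<^esub> {A_poly q, G_poly k, H_poly m}
    \<and> (is_reduced_groebner_basis (pretzel_AG 2 k r m) I
       \<and> (\<forall>B. is_reduced_groebner_basis B I \<longrightarrow> B = pretzel_AG 2 k r m))
    \<and> I +>\<^bsub>Poly_Qxy\<^esub> (laurent_x * laurent_y) ^ k = \<one>\<^bsub>Poly_Qxy Quot I\<^esub>
    \<and> I +>\<^bsub>Poly_Qxy\<^esub> laurent_x ^ m = I +>\<^bsub>Poly_Qxy\<^esub> laurent_y ^ m"
proof -
  have q: "odd q" using assms(3,4) by simp
  define J where "J = Idl\<^bsub>ring_on poly_set\<^esub> {A_poly q, G_poly k, H_poly m}"
  note AGH = A_G_H_in_poly_set(1)[OF q] A_G_H_in_poly_set(2,3)[OF q]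
  have xy: "laurent_x \<in> poly_set" "laurent_y \<in> poly_set"
    by (simp_all add: laurent_x_def laurent_y_def single_in_poly_set_iff)
  have J: "ideal J (ring_on poly_set)"
    unfolding J_def using AGH by (intro ideal_genideal_ring_on[OF subring_set_poly_set]) auto
  note closed = ideal_ring_onD[OF subring_set_poly_set J]
  have "{A_poly q, G_poly k, H_poly m} \<subseteq> J"
    unfolding J_def using AGH by (intro genideal_ring_on_superset[OF subring_set_poly_set]) auto
  then have "G_poly k * (1 - laurent_x * laurent_y) \<in> J" "H_poly m * (laurent_x - laurent_y) \<in> J"
    using xy by (auto intro!: closed(5) poly_set_simps)
  then have G: "1 - (laurent_x * laurent_y) ^ k \<in> J" and H: "laurent_x ^ m - laurent_y ^ m \<in> J"
    by (simp_all only: G_poly_mult H_poly_mult)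
  have I: "I = J"
    unfolding assms(5) Poly_Qxy_eq ring_on_simps(1) pretzel_elementary_ideal_2[OF assms(2,3)] J_def assms(4)[symmetric]
    using G by (intro laurent_ideal_contraction[OF assms(1) AGH]) (simp add: J_def)
  have AG: "is_reduced_groebner_basis (pretzel_AG 2 k r m) I"
    unfolding AG_def assms(5)[symmetric] I by (rule theI'[OF reduced_groebner_basis_ex1[OF J]])
  have unique: "B = pretzel_AG 2 k r m" if "is_reduced_groebner_basis B I" for B
    using reduced_groebner_basis_ex1[OF J] that AG unfolding I by blast
  have "(laurent_x * laurent_y) ^ k - 1 \<in> J"
    using closed(6)[OF G] by simp
  then have "I +>\<^bsub>Poly_Qxy\<^esub> (laurent_x * laurent_y) ^ k = I +>\<^bsub>Poly_Qxy\<^esub> 1"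
    unfolding I Poly_Qxy_eq using xy
    by (intro coset_ring_on_eqI[OF subring_set_poly_set J] poly_set_simps)
  then have xy_power: "I +>\<^bsub>Poly_Qxy\<^esub> (laurent_x * laurent_y) ^ k = \<one>\<^bsub>Poly_Qxy Quot I\<^esub>"
    by (simp add: FactRing_def Poly_Qxy_eq)
  have x_power: "I +>\<^bsub>Poly_Qxy\<^esub> laurent_x ^ m = I +>\<^bsub>Poly_Qxy\<^esub> laurent_y ^ m"
    unfolding I Poly_Qxy_eq using xy H
    by (intro coset_ring_on_eqI[OF subring_set_poly_set J] poly_set_simps)
  have "I = Idl\<^bsub>Poly_Qxy\<^esub> {A_poly q, G_poly k, H_poly m}"
    by (simp only: I J_def Poly_Qxy_eq)
  then show ?thesis
    by (intro conjI allI impI AG unique xy_power x_power)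
qed

end
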